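(* Let $0<\alpha<2$, $\beta\in(1,2]$ and $H'\in(0,1)$. Let $\{A_t\}_{t\ge 0}$ be a non-degenerate symmetric $\beta$-stable process with stationary increments, self-similar with exponent $H'$, defined on a probability space $(\Omega',\mathcal F',\mathbf P')$. Let $M$ be a symmetric $\alpha$-stable random measure with control measure $\mathbf P'\times\lambda$ on $\Omega'\times\mathbb R$, living on another probability space $(\Omega,\mathcal F,\mathbf P)$, where $\lambda$ is Lebesgue measure on $\mathbb R$. Then the process $$Y_A^{H}(t):=\int_{\Omega'}\int_{\mathbb R}1_{[0,A_t(\omega')]}(x)\,M(d\omega',dx),\qquad t\ge 0,$$ is a well-defined symmetric $\alpha$-stable process, it has stationary increments, and it is self-similar with exponent $H=H'/\alpha$.
   Context: Interval convention: for real $a,b$ with $b<a$, $[a,b]$ denotes $[b,a]$; so $[0,A_t]$ means $[A_t,0]$ when $A_t<0$. A process is symmetric $\alpha$-stable (S$\alpha$S) if all finite linear combinations of its values are S$\alpha$S random variables; $S_\alpha(\sigma)$ denotes the S$\alpha$S law with scale parameter $\sigma$, i.e. with characteristic function $\theta\mapsto\exp(-\sigma^\alpha|\theta|^\alpha)$. (The same applies with $\beta$ in place of $\alpha$; $\beta=2$ is the centered Gaussian case.) A process $\{X(t)\}_{t\ge0}$ is self-similar with exponent $H$ if for every $c>0$ the processes $\{X(ct)\}_{t\ge 0}$ and $\{c^{H}X(t)\}_{t\ge 0}$ have the same finite-dimensional distributions. It has stationary increments if for every $h\ge 0$ the processes $\{X(t+h)-X(h)\}_{t\ge0}$ and $\{X(t)-X(0)\}_{t\ge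 0}$ have the same finite-dimensional distributions. By self-similarity, $A_0=0$ almost surely. Given a $\sigma$-finite measure $m$ on a measurable space $(B,\mathcal B)$, put $\mathcal B_0=\{A\in\mathcal B:m(A)<\infty\}$. An S$\alpha$S random measure $M$ with control measure $m$ is a $\sigma$-additive random set function on $\mathcal B_0$ such that $M(A)\sim S_\alpha(m(A)^{1/\alpha})$ for $A\in\mathcal B_0$, and such that $M$ is independently scattered: its values on disjoint sets are independent. The stable integral $\int f\,dM$ is defined for $f\in L^\alpha(B,m)$ and is S$\alpha$S with $\mathbf E\exp(i\theta\int f\,dM)=\exp(-|\theta|^\alpha\int|f|^\alpha\,dm)$. "Well-defined" means that for each $t\ge0$ the kernel belongs to $L^\alpha(\Omega'\times\mathbb R,\mathbf P'\times\lambda)$, so that the stable integral exists. *)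

theory Defs
  imports "HOL-Probability.Probability"
begin

text \<open>\<open>X\<close> has law \<open>S\<^sub>\<alpha>(\<sigma>)\<close> under \<open>P\<close>. The value \<open>\<sigma> = 0\<close> (point mass at 0) is allowed; for \<open>\<alpha> = 2\<close>
  this is the centred Gaussian law of variance \<open>2 \<sigma>\<^sup>2\<close>.\<close>

definition has_SaS_law :: "'w measure \<Rightarrow> real \<Rightarrow> real \<Rightarrow> ('w \<Rightarrow> real) \<Rightarrow> bool" where
  "has_SaS_law P \<alpha> \<sigma> X \<longleftrightarrow>
     X \<in> borel_measurable P \<and>
     (\<forall>\<theta>. char (distr P borel X) \<theta> = complex_of_real (exp (- (\<sigma> powr \<alpha>) * \<bar>\<theta>\<bar> powr \<alpha>)))"

definition SaS_variable :: "'w measure \<Rightarrow> real \<Rightarrow> ('w \<Rightarrow> real) \<Rightarrow> bool" where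
  "SaS_variable P \<alpha> X \<longleftrightarrow> (\<exists>\<sigma>\<ge>0. has_SaS_law P \<alpha> \<sigma> X)"

text \<open>Processes \<open>{X(t)}\<close>, \<open>t \<ge> 0\<close>, are functions of \<open>t :: real\<close>; their values at negative times are
  irrelevant to all notions below.\<close>

definition SaS_process :: "'w measure \<Rightarrow> real \<Rightarrow> (real \<Rightarrow> 'w \<Rightarrow> real) \<Rightarrow> bool" where
  "SaS_process P \<alpha> X \<longleftrightarrow>
     (\<forall>J a. finite J \<longrightarrow> J \<subseteq> {0..} \<longrightarrow> SaS_variable P \<alpha> (\<lambda>\<omega>. \<Sum>t\<in>J. a t * X t \<omega>))"

definition nondegenerate_process :: "'w measure \<Rightarrow> (real \<Rightarrow> 'w \<Rightarrow> real) \<Rightarrow> bool" where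
  "nondegenerate_process P X \<longleftrightarrow> (\<exists>t\<ge>0. \<not> (\<exists>c. AE \<omega> in P. X t \<omega> = c))"

definition fdd :: "'w measure \<Rightarrow> (real \<Rightarrow> 'w \<Rightarrow> real) \<Rightarrow> real set \<Rightarrow> (real \<Rightarrow> real) measure" where
  "fdd P X J = distr P (PiM J (\<lambda>_. borel)) (\<lambda>\<omega>. \<lambda>t\<in>J. X t \<omega>)"

definition same_fdds :: "'w measure \<Rightarrow> (real \<Rightarrow> 'w \<Rightarrow> real) \<Rightarrow> (real \<Rightarrow> 'w \<Rightarrow> real) \<Rightarrow> bool" where
  "same_fdds P X Z \<longleftrightarrow> (\<forall>J. finite J \<longrightarrow> J \<subseteq> {0..} \<longrightarrow> fdd P X J = fdd P Z J)"

definition self_similar :: "'w measure \<Rightarrow> real \<Rightarrow> (real \<Rightarrow> 'w \<Rightarrow> real) \<Rightarrow> bool" where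
  "self_similar P H X \<longleftrightarrow>
     (\<forall>c>0. same_fdds P (\<lambda>t. X (c * t)) (\<lambda>t \<omega>. c powr H * X t \<omega>))"

definition stationary_increments :: "'w measure \<Rightarrow> (real \<Rightarrow> 'w \<Rightarrow> real) \<Rightarrow> bool" where
  "stationary_increments P X \<longleftrightarrow>
     (\<forall>h\<ge>0. same_fdds P (\<lambda>t \<omega>. X (t + h) \<omega> - X h \<omega>) (\<lambda>t \<omega>. X t \<omega> - X 0 \<omega>))"

definition finite_measure_sets :: "'b measure \<Rightarrow> 'b set set" where
  "finite_measure_sets m = {A \<in> sets m. emeasure m A < \<infinity>}"

text \<open>\<open>\<sigma>\<close>-additivity is the usual almost sure one; the exceptional null set may depend on the
  sequence of sets.\<close>

definition SaS_random_measure ::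
    "'w measure \<Rightarrow> real \<Rightarrow> 'b measure \<Rightarrow> ('b set \<Rightarrow> 'w \<Rightarrow> real) \<Rightarrow> bool" where
  "SaS_random_measure P \<alpha> m M \<longleftrightarrow>
     sigma_finite_measure m \<and>
     (\<forall>A \<in> finite_measure_sets m. has_SaS_law P \<alpha> (measure m A powr (1 / \<alpha>)) (M A)) \<and>
     (\<forall>I (A :: nat \<Rightarrow> 'b set).
        finite I \<longrightarrow> A ` I \<subseteq> finite_measure_sets m \<longrightarrow> disjoint_family_on A I \<longrightarrow>
        prob_space.indep_vars P (\<lambda>_. borel) (\<lambda>i. M (A i)) I) \<and>
     (\<forall>A :: nat \<Rightarrow> 'b set.
        range A \<subseteq> finite_measure_sets m \<longrightarrow> (\<Union>i. A i) \<in> finite_measure_sets m \<longrightarrow>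
        disjoint_family A \<longrightarrow>
        (AE \<omega> in P. (\<lambda>i. M (A i) \<omega>) sums M (\<Union>i. A i) \<omega>))"

definition L_space :: "real \<Rightarrow> 'b measure \<Rightarrow> ('b \<Rightarrow> real) set" where
  "L_space \<alpha> m = {f \<in> borel_measurable m. integrable m (\<lambda>x. \<bar>f x\<bar> powr \<alpha>)}"

definition simple_stable_integral ::
    "'b measure \<Rightarrow> ('b set \<Rightarrow> 'w \<Rightarrow> real) \<Rightarrow> ('b \<Rightarrow> real) \<Rightarrow> 'w \<Rightarrow> real" where
  "simple_stable_integral m M f \<omega> =
     (\<Sum>y \<in> f ` space m - {0}. y * M (f -` {y} \<inter> space m) \<omega>)"

definition converges_in_probability ::
    "'w measure \<Rightarrow> (nat \<Rightarrow> 'w \<Rightarrow> real) \<Rightarrow> ('w \<Rightarrow> real) \<Rightarrow> bool" where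
  "converges_in_probability P X Z \<longleftrightarrow>
     (\<forall>\<epsilon>>0. (\<lambda>n. measure P {\<omega> \<in> space P. \<bar>X n \<omega> - Z \<omega>\<bar> > \<epsilon>}) \<longlonglongrightarrow> 0)"

text \<open>The stable integral of \<open>f \<in> L\<^sup>\<alpha>\<close> is the limit in probability of the integrals of simple functions
  approximating \<open>f\<close> in \<open>L\<^sup>\<alpha>\<close>. It is determined only up to almost sure equality, hence
  it is a relation: \<open>X\<close> is a version of the integral of \<open>f\<close> with respect to \<open>M\<close>.\<close>

definition has_stable_integral ::
    "'w measure \<Rightarrow> real \<Rightarrow> 'b measure \<Rightarrow> ('b set \<Rightarrow> 'w \<Rightarrow> real) \<Rightarrow> ('b \<Rightarrow> real) \<Rightarrow> ('w \<Rightarrow> real) \<Rightarrow> bool"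
where
  "has_stable_integral P \<alpha> m M f X \<longleftrightarrow>
     f \<in> L_space \<alpha> m \<and> X \<in> borel_measurable P \<and>
     (\<exists>s :: nat \<Rightarrow> 'b \<Rightarrow> real.
        (\<forall>n. simple_function m (s n) \<and> s n \<in> L_space \<alpha> m) \<and>
        (\<lambda>n. \<integral>x. \<bar>s n x - f x\<bar> powr \<alpha> \<partial>m) \<longlonglongrightarrow> 0 \<and>
        converges_in_probability P (\<lambda>n. simple_stable_integral m M (s n)) X)"

text \<open>\<^const>\<open>closed_segment\<close> on the reals is the interval between its two arguments, in either order.\<close>

definition Y_kernel :: "(real \<Rightarrow> 'v \<Rightarrow> real) \<Rightarrow> real \<Rightarrow> 'v \<times> real \<Rightarrow> real" where
  "Y_kernel A t = (\<lambda>(\<omega>', x). indicator (closed_segment 0 (A t \<omega>')) x)"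

end

theory Submission
  imports Defs
begin

text \<open>The kernel at time \<open>t\<close> is the indicator of the set \<open>E\<^sub>t\<close> of all \<open>(\<omega>', x)\<close> with \<open>x\<close> between \<open>0\<close> and
  \<open>A\<^sub>t(\<omega>')\<close>. Under \<open>P' \<times> \<lambda>\<close> this set has measure \<open>E\<bar>A\<^sub>t\<bar>\<close>, which is finite because the
  characteristic function of a symmetric \<open>\<beta>\<close>-stable variable with \<open>\<beta> > 1\<close> differs from \<open>1\<close> by
  \<open>O(\<bar>\<theta>\<bar>\<^sup>\<beta>)\<close> at the origin (\<open>integrable_SaS_law\<close>). So the kernel is a simple function, \<open>M(E\<^sub>t)\<close> is a
  version of its integral, and any other version equals \<open>M(E\<^sub>t)\<close> almost surely
  (\<open>stable_integral_indicator_AE\<close>).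

  Splitting finitely many sets into the disjoint atoms that they generate and using that \<open>M\<close> is
  additive and independently scattered, one finds that \<open>\<Sum> a\<^sub>t Y(t)\<close> has the characteristic function
  \<open>exp(-\<bar>\<theta>\<bar>\<^sup>\<alpha> \<integral> \<bar>\<Sum> a\<^sub>t 1\<^bsub>[0,A\<^sub>t]\<^esub>\<bar>\<^sup>\<alpha>)\<close> (\<open>char_sum_stable_integrals\<close>). This is an \<open>S\<alpha>S\<close> law. Since a
  finite-dimensional law is determined by the characteristic functions of the linear combinations
  of its coordinates (\<open>same_fddsI\<close>), stationarity of the increments and self-similarity become
  equalities between integrals of this kind.

  By Fubini, each of these integrals is the expectation of
  \<open>\<Psi>(u) = \<integral> \<bar>\<Sum> a\<^sub>t 1\<^bsub>[0,u\<^sub>t]\<^esub>(x)\<bar>\<^sup>\<alpha> dx\<close> (\<open>segment_energy\<close>) at a random vector \<open>u\<close> built from \<open>A\<close>; only its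
  law matters. Self-similarity holds since \<open>\<Psi>(c u) = c \<Psi>(u)\<close> for \<open>c > 0\<close>: a factor \<open>c\<^sup>H\<^sup>'\<close> of \<open>A\<close> becomes the factor
  \<open>c\<^sup>H\<^sup>' = (c\<^bsup>H'/\<alpha>\<^esup>)\<^sup>\<alpha>\<close> in the exponent, which is what multiplying \<open>Y\<close> by \<open>c\<^bsup>H'/\<alpha>\<^esup>\<close> produces. For the
  increments, \<open>1\<^bsub>[0,u]\<^esub>(x) = sgn(x) (1\<^bsub>x<u\<^esub> - 1\<^bsub>x<0\<^esub>)\<close> for almost every \<open>x\<close>, whatever the sign of \<open>u\<close>. The
  difference of two such indicators is therefore \<open>sgn(x) (1\<^bsub>x<u\<^esub> - 1\<^bsub>x<v\<^esub>)\<close>; the common sign disappears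
  in the absolute value, and translating \<open>x\<close> by \<open>v\<close> shows that
  \<open>\<integral> \<bar>\<Sum> a\<^sub>t (1\<^bsub>[0,u\<^sub>t]\<^esub> - 1\<^bsub>[0,v]\<^esub>)\<bar>\<^sup>\<alpha> dx = \<Psi>((u\<^sub>t - v)\<^sub>t)\<close> (\<open>segment_energy_diff\<close>). With \<open>v = A\<^sub>h\<close> only the law of
  the increments of \<open>A\<close> enters.\<close>

section \<open>Characteristic functions and finite-dimensional laws\<close>

lemma char_distr_eq:
  assumes "X \<in> borel_measurable P"
  shows "char (distr P borel X) \<theta> = (CLINT \<omega>|P. iexp (\<theta> * X \<omega>))"
  using assms unfolding char_def by (subst integral_distr) auto

lemma AE_zero_if_char_one:
  assumes "prob_space P" and X[measurable]: "X \<in> borel_measurable P"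
    and one: "\<And>\<theta>. char (distr P borel X) \<theta> = 1"
  shows "AE \<omega> in P. X \<omega> = 0"
proof -
  interpret prob_space P by fact
  interpret D: real_distribution "distr P borel X"
    by (simp add: X real_distribution_def real_distribution_axioms_def prob_space_distr)
  interpret R: real_distribution "return borel (0::real)"
    by (simp add: real_distribution_def real_distribution_axioms_def prob_space_return)
  have "char (return borel 0) \<theta> = 1" for \<theta>
    unfolding char_def by (subst integral_return) auto
  then have "distr P borel X = return borel 0"
    using one by (intro Levy_uniqueness D.real_distribution_axioms R.real_distribution_axioms) auto
  moreover have "AE x in return borel (0::real). x = 0"
    by (subst AE_return) auto
  ultimately have "AE x in distr P borel X. x = 0" by (simp only:)
  then show ?thesis
    by (subst (asm) AE_distr_iff) auto
qed

text \<open>The law of \<open>X\<close> under the probability measure with density proportional to the weight \<open>W\<close>. It allows the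
  uniqueness theorem for laws on the real line to be applied to weighted expectations
  \<open>E(W e\<^bsup>iaX\<^esup>)\<close>.\<close>

definition tilted_law :: "'a measure \<Rightarrow> ('a \<Rightarrow> real) \<Rightarrow> ('a \<Rightarrow> real) \<Rightarrow> real measure" where
  "tilted_law \<mu> W X = distr (density \<mu> (\<lambda>x. ennreal (W x / (LINT y|\<mu>. W y)))) borel X"

lemma
  fixes W :: "'a \<Rightarrow> real"
  assumes "prob_space \<mu>"
    and m[measurable]: "X \<in> borel_measurable \<mu>" "W \<in> borel_measurable \<mu>"
    and W: "\<And>x. 1 \<le> W x" "\<And>x. W x \<le> 3"
  shows one_le_weight_integral: "1 \<le> (LINT y|\<mu>. W y)"
    and real_distribution_tilted_law: "real_distribution (tilted_law \<mu> W X)"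
    and integral_tilted_law: "\<And>f :: real \<Rightarrow> 'c :: {banach, second_countable_topology}.
      f \<in> borel_measurable borel \<Longrightarrow>
      (\<integral>y. f y \<partial>tilted_law \<mu> W X) = (1 / (LINT y|\<mu>. W y)) *\<^sub>R (\<integral>x. W x *\<^sub>R f (X x) \<partial>\<mu>)"
proof -
  interpret prob_space \<mu> by fact
  have bd: "\<bar>W x\<bar> \<le> 3" for x using W[of x] by simp
  have iW: "integrable \<mu> W"
    by (rule integrable_const_bound[where B=3]) (use bd in auto)
  have "(LINT y|\<mu>. 1) \<le> (LINT y|\<mu>. W y)"
    by (rule integral_mono) (use iW W in auto)
  then show one: "1 \<le> (LINT y|\<mu>. W y)" by (simp add: prob_space)
  define c where "c = (LINT y|\<mu>. W y)"
  have c: "c > 0" using one by (simp add: c_def)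
  have W0: "0 \<le> W x" for x using W(1)[of x] by simp
  have "(\<integral>\<^sup>+x. ennreal (W x / c) \<partial>\<mu>) = ennreal (LINT x|\<mu>. W x / c)"
    by (rule nn_integral_eq_integral) (use iW c W0 in auto)
  also have "(LINT x|\<mu>. W x / c) = 1" using c by (simp add: c_def)
  finally have "emeasure (density \<mu> (\<lambda>x. ennreal (W x / c))) (space \<mu>) = 1"
    by (subst emeasure_density) (auto cong: nn_integral_cong)
  then interpret D: prob_space "density \<mu> (\<lambda>x. ennreal (W x / c))"
    by (intro prob_spaceI) simp
  show "real_distribution (tilted_law \<mu> W X)"
    unfolding tilted_law_def c_def[symmetric] real_distribution_def real_distribution_axioms_def
    by (auto intro!: D.prob_space_distr)
  fix f :: "real \<Rightarrow> 'c" assume [measurable]: "f \<in> borel_measurable borel"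
  have "(\<integral>y. f y \<partial>tilted_law \<mu> W X) = (\<integral>x. f (X x) \<partial>density \<mu> (\<lambda>x. ennreal (W x / c)))"
    unfolding tilted_law_def c_def[symmetric] by (subst integral_distr) auto
  also have "\<dots> = (\<integral>x. (W x / c) *\<^sub>R f (X x) \<partial>\<mu>)"
    by (rule integral_density) (use c W0 in auto)
  also have "\<dots> = (\<integral>x. (1 / c) *\<^sub>R (W x *\<^sub>R f (X x)) \<partial>\<mu>)" by simp
  also have "\<dots> = (1 / c) *\<^sub>R (\<integral>x. W x *\<^sub>R f (X x) \<partial>\<mu>)" by (rule integral_scaleR_right)
  finally show "(\<integral>y. f y \<partial>tilted_law \<mu> W X)
      = (1 / (LINT y|\<mu>. W y)) *\<^sub>R (\<integral>x. W x *\<^sub>R f (X x) \<partial>\<mu>)" by (simp add: c_def)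
qed

text \<open>A positive weight only changes the underlying probability measure, so uniqueness of the
  characteristic function of the tilted law gives the claim. The bounds on the weight keep the
  normalising constant finite and away from \<open>0\<close>; taking \<open>a = 0\<close> shows that both sides have the same one.\<close>

lemma weighted_char_unique_pos:
  fixes W :: "'a \<Rightarrow> real" and W' :: "'b \<Rightarrow> real"
  assumes \<mu>: "prob_space \<mu>" and \<nu>: "prob_space \<nu>"
    and mX: "X \<in> borel_measurable \<mu>" "W \<in> borel_measurable \<mu>"
    and mX': "X' \<in> borel_measurable \<nu>" "W' \<in> borel_measurable \<nu>"
    and W: "\<And>x. 1 \<le> W x" "\<And>x. W x \<le> 3" and W': "\<And>x. 1 \<le> W' x" "\<And>x. W' x \<le> 3"
    and eq: "\<And>a. (CLINT x|\<mu>. W x *\<^sub>R iexp (a * X x)) = (CLINT x|\<nu>. W' x *\<^sub>R iexp (a * X' x))"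
    and B[measurable]: "B \<in> sets borel"
  shows "(LINT x|\<mu>. W x * indicator B (X x)) = (LINT x|\<nu>. W' x * indicator B (X' x))"
proof -
  note D = real_distribution_tilted_law[OF \<mu> mX W] real_distribution_tilted_law[OF \<nu> mX' W']
  have measurable_iexp: "(\<lambda>x. iexp (a * x)) \<in> borel_measurable borel" for a by measurable
  note I = integral_tilted_law[OF \<mu> mX W] integral_tilted_law[OF \<nu> mX' W']
  have "complex_of_real (LINT x|\<mu>. W x) = complex_of_real (LINT x|\<nu>. W' x)"
    using eq[of 0] by (simp add: scaleR_conv_of_real)
  then have c: "(LINT x|\<mu>. W x) = (LINT x|\<nu>. W' x)" by (simp only: of_real_eq_iff)
  have "char (tilted_law \<mu> W X) = char (tilted_law \<nu> W' X')"
    unfolding char_def by (rule ext) (simp only: I(1)[OF measurable_iexp] I(2)[OF measurable_iexp] eq c)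
  then have "tilted_law \<mu> W X = tilted_law \<nu> W' X'"
    by (rule Levy_uniqueness[OF D])
  then have "(LINT y|tilted_law \<mu> W X. indicator B y) = (LINT y|tilted_law \<nu> W' X'. indicator B y :: real)"
    by simp
  then show ?thesis
    using one_le_weight_integral[OF \<nu> mX' W'] by (simp add: I c del: Bochner_Integration.integral_indicator)
qed

text \<open>A bounded signed weight \<open>U\<close> is the difference of the positive weights \<open>2 + U\<close> and \<open>2\<close>.\<close>

lemma weighted_char_unique_real:
  fixes U :: "'a \<Rightarrow> real" and U' :: "'b \<Rightarrow> real"
  assumes \<mu>: "prob_space \<mu>" and \<nu>: "prob_space \<nu>"
    and mX[measurable]: "X \<in> borel_measurable \<mu>" "U \<in> borel_measurable \<mu>"
    and mX'[measurable]: "X' \<in> borel_measurable \<nu>" "U' \<in> borel_measurable \<nu>"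
    and U: "\<And>x. \<bar>U x\<bar> \<le> 1" and U': "\<And>x. \<bar>U' x\<bar> \<le> 1"
    and eq1: "\<And>a. (CLINT x|\<mu>. iexp (a * X x)) = (CLINT x|\<nu>. iexp (a * X' x))"
    and eq: "\<And>a. (CLINT x|\<mu>. U x *\<^sub>R iexp (a * X x)) = (CLINT x|\<nu>. U' x *\<^sub>R iexp (a * X' x))"
    and B[measurable]: "B \<in> sets borel"
  shows "(LINT x|\<mu>. U x * indicator B (X x)) = (LINT x|\<nu>. U' x * indicator B (X' x))"
proof -
  interpret \<mu>: prob_space \<mu> by fact
  interpret \<nu>: prob_space \<nu> by fact
  have U2: "1 \<le> 2 + U x" "2 + U x \<le> 3" for x using U[of x] by linarith+
  have U2': "1 \<le> 2 + U' x" "2 + U' x \<le> 3" for x using U'[of x] by linarith+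
  have i[simp]: "complex_integrable \<mu> (\<lambda>x. iexp (a * X x))" for a
    by (rule \<mu>.integrable_const_bound[where B=1]) auto
  have i'[simp]: "complex_integrable \<nu> (\<lambda>x. iexp (a * X' x))" for a
    by (rule \<nu>.integrable_const_bound[where B=1]) auto
  have j[simp]: "complex_integrable \<mu> (\<lambda>x. U x *\<^sub>R iexp (a * X x))" for a
    by (rule \<mu>.integrable_const_bound[where B=1]) (use U in auto)
  have j'[simp]: "complex_integrable \<nu> (\<lambda>x. U' x *\<^sub>R iexp (a * X' x))" for a
    by (rule \<nu>.integrable_const_bound[where B=1]) (use U' in auto)
  have k[simp]: "integrable \<mu> (\<lambda>x. U x * indicator B (X x))"
    by (rule \<mu>.integrable_const_bound[where B=1]) (use U in \<open>auto simp: indicator_def\<close>)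
  have k'[simp]: "integrable \<nu> (\<lambda>x. U' x * indicator B (X' x))"
    by (rule \<nu>.integrable_const_bound[where B=1]) (use U' in \<open>auto simp: indicator_def\<close>)
  have l[simp]: "integrable \<mu> (\<lambda>x. indicator B (X x) :: real)"
    by (rule \<mu>.integrable_const_bound[where B=1]) (auto simp: indicator_def)
  have l'[simp]: "integrable \<nu> (\<lambda>x. indicator B (X' x) :: real)"
    by (rule \<nu>.integrable_const_bound[where B=1]) (auto simp: indicator_def)
  have "(LINT x|\<mu>. (2 + U x) * indicator B (X x)) = (LINT x|\<nu>. (2 + U' x) * indicator B (X' x))"
  proof (rule weighted_char_unique_pos[OF \<mu> \<nu>])
    fix a
    show "(CLINT x|\<mu>. (2 + U x) *\<^sub>R iexp (a * X x)) = (CLINT x|\<nu>. (2 + U' x) *\<^sub>R iexp (a * X' x))"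
      unfolding scaleR_left_distrib
      unfolding Bochner_Integration.integral_add[OF integrable_scaleR_right[OF i] j]
        Bochner_Integration.integral_add[OF integrable_scaleR_right[OF i'] j']
      by (simp only: integral_scaleR_right eq eq1)
  qed (use U2 U2' in auto)
  moreover have "(LINT x|\<mu>. 1 * indicator B (X x)) = (LINT x|\<nu>. 1 * indicator B (X' x) :: real)"
    by (rule weighted_char_unique_pos[OF \<mu> \<nu>]) (use eq1 in auto)
  ultimately show ?thesis by (simp add: distrib_right)
qed

text \<open>The real and imaginary parts of the weight can be treated separately: conjugation together with
  \<open>a \<mapsto> -a\<close> turns the hypothesis for \<open>W\<close> into the same hypothesis for its conjugate.\<close>

lemma weighted_char_unique:
  fixes W :: "'a \<Rightarrow> complex" and W' :: "'b \<Rightarrow> complex"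
  assumes \<mu>: "prob_space \<mu>" and \<nu>: "prob_space \<nu>"
    and mX[measurable]: "X \<in> borel_measurable \<mu>" "W \<in> borel_measurable \<mu>"
    and mX'[measurable]: "X' \<in> borel_measurable \<nu>" "W' \<in> borel_measurable \<nu>"
    and W: "\<And>x. norm (W x) \<le> 1" and W': "\<And>x. norm (W' x) \<le> 1"
    and eq1: "\<And>a. (CLINT x|\<mu>. iexp (a * X x)) = (CLINT x|\<nu>. iexp (a * X' x))"
    and eq: "\<And>a. (CLINT x|\<mu>. W x * iexp (a * X x)) = (CLINT x|\<nu>. W' x * iexp (a * X' x))"
    and B[measurable]: "B \<in> sets borel"
  shows "(CLINT x|\<mu>. W x * indicator B (X x)) = (CLINT x|\<nu>. W' x * indicator B (X' x))"
proof -
  interpret \<mu>: prob_space \<mu> by fact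
  interpret \<nu>: prob_space \<nu> by fact
  have i[simp]: "complex_integrable \<mu> (\<lambda>x. W x * iexp (a * X x))" for a
    by (rule \<mu>.integrable_const_bound[where B=1]) (use W in \<open>auto simp: norm_mult\<close>)
  have i'[simp]: "complex_integrable \<nu> (\<lambda>x. W' x * iexp (a * X' x))" for a
    by (rule \<nu>.integrable_const_bound[where B=1]) (use W' in \<open>auto simp: norm_mult\<close>)
  have k[simp]: "complex_integrable \<mu> (\<lambda>x. W x * indicator B (X x))"
    by (rule \<mu>.integrable_const_bound[where B=1]) (use W in \<open>auto simp: indicator_def norm_mult\<close>)
  have k'[simp]: "complex_integrable \<nu> (\<lambda>x. W' x * indicator B (X' x))"
    by (rule \<nu>.integrable_const_bound[where B=1]) (use W' in \<open>auto simp: indicator_def norm_mult\<close>)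
  have cnj_flip: "(\<lambda>x. cnj (w x) * iexp (a * x' x)) = (\<lambda>x. cnj (w x * iexp (- a * x' x)))"
    for w :: "'z \<Rightarrow> complex" and x' :: "'z \<Rightarrow> real" and a by (auto simp: exp_cnj)
  have i2: "complex_integrable \<mu> (\<lambda>x. cnj (W x) * iexp (a * X x))" for a
    unfolding cnj_flip by (rule integrable_cnj) (rule i)
  have i2': "complex_integrable \<nu> (\<lambda>x. cnj (W' x) * iexp (a * X' x))" for a
    unfolding cnj_flip by (rule integrable_cnj) (rule i')
  have eq2: "(CLINT x|\<mu>. cnj (W x) * iexp (a * X x)) = (CLINT x|\<nu>. cnj (W' x) * iexp (a * X' x))" for a
    unfolding cnj_flip Bochner_Integration.integral_cnj by (simp only: eq)
  have re: "Re w *\<^sub>R z = (w * z + cnj w * z) / 2" for w z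
    by (simp add: distrib_right[symmetric] complex_add_cnj scaleR_conv_of_real)
  have im: "Im w *\<^sub>R z = (w * z - cnj w * z) / (2 * \<i>)" for w z
  proof -
    have "w * z - cnj w * z = (2 * \<i>) * (Im w *\<^sub>R z)"
      by (rule complex_eqI) (simp_all add: algebra_simps)
    moreover have "2 * \<i> \<noteq> (0 :: complex)" by simp
    ultimately show ?thesis by (simp only: nonzero_mult_div_cancel_left not_False_eq_True)
  qed
  have 1: "(LINT x|\<mu>. Re (W x) * indicator B (X x)) = (LINT x|\<nu>. Re (W' x) * indicator B (X' x))"
  proof (rule weighted_char_unique_real[OF \<mu> \<nu>])
    fix a show "(CLINT x|\<mu>. Re (W x) *\<^sub>R iexp (a * X x)) = (CLINT x|\<nu>. Re (W' x) *\<^sub>R iexp (a * X' x))"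
      unfolding re by (simp only: integral_divide_zero Bochner_Integration.integral_add[OF i i2]
          Bochner_Integration.integral_add[OF i' i2'] eq eq2)
  qed (use W W' eq1 in \<open>auto intro: order_trans[OF abs_Re_le_cmod]\<close>)
  have 2: "(LINT x|\<mu>. Im (W x) * indicator B (X x)) = (LINT x|\<nu>. Im (W' x) * indicator B (X' x))"
  proof (rule weighted_char_unique_real[OF \<mu> \<nu>])
    fix a show "(CLINT x|\<mu>. Im (W x) *\<^sub>R iexp (a * X x)) = (CLINT x|\<nu>. Im (W' x) *\<^sub>R iexp (a * X' x))"
      unfolding im by (simp only: integral_divide_zero Bochner_Integration.integral_diff[OF i i2]
          Bochner_Integration.integral_diff[OF i' i2'] eq eq2)
  qed (use W W' eq1 in \<open>auto intro: order_trans[OF abs_Im_le_cmod]\<close>)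
  have Re_Im: "Re (w * indicator B y) = Re w * indicator B y" "Im (w * indicator B y) = Im w * indicator B y"
    for w y by (simp_all add: indicator_def)
  show ?thesis
  proof (rule complex_eqI)
    show "Re (CLINT x|\<mu>. W x * indicator B (X x)) = Re (CLINT x|\<nu>. W' x * indicator B (X' x))"
      unfolding integral_Re[OF k, symmetric] integral_Re[OF k', symmetric] Re_Im by (rule 1)
    show "Im (CLINT x|\<mu>. W x * indicator B (X x)) = Im (CLINT x|\<nu>. W' x * indicator B (X' x))"
      unfolding integral_Im[OF k, symmetric] integral_Im[OF k', symmetric] Re_Im by (rule 2)
  qed
qed

text \<open>The exponentials \<open>e\<^bsup>i a\<^sub>j x\<^sub>j\<^esup>\<close> are exchanged for indicators of Borel sets one coordinate at a time. In
  each exchange the factors of all other coordinates form a bounded complex weight, so that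
  one-dimensional uniqueness applies. After all exchanges the equality says that the two measures
  agree on boxes.\<close>

lemma PiM_eqI_char:
  fixes \<mu> \<nu> :: "('i \<Rightarrow> real) measure"
  assumes \<mu>: "prob_space \<mu>" and \<nu>: "prob_space \<nu>" and J: "finite J"
    and s: "sets \<mu> = sets (PiM J (\<lambda>_. borel))" "sets \<nu> = sets (PiM J (\<lambda>_. borel))"
    and eq: "\<And>a. (CLINT x|\<mu>. iexp (\<Sum>j\<in>J. a j * x j)) = (CLINT x|\<nu>. iexp (\<Sum>j\<in>J. a j * x j))"
  shows "\<mu> = \<nu>"
proof -
  interpret \<mu>: prob_space \<mu> by fact
  interpret \<nu>: prob_space \<nu> by fact
  note [measurable_cong] = s
  have mixed: "(CLINT x|\<mu>. (\<Prod>j\<in>K. indicator (B j) (x j)) * iexp (\<Sum>j\<in>J-K. a j * x j))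
      = (CLINT x|\<nu>. (\<Prod>j\<in>K. indicator (B j) (x j)) * iexp (\<Sum>j\<in>J-K. a j * x j))"
    if "finite K" "K \<subseteq> J" and "\<And>j. j \<in> K \<Longrightarrow> B j \<in> sets borel" for K and a :: "'i \<Rightarrow> real" and B :: "'i \<Rightarrow> real set"
    using that
  proof (induction K arbitrary: a)
    case empty
    then show ?case using eq[of a] by simp
  next
    case (insert k K)
    have [measurable]: "B j \<in> sets borel" if "j \<in> insert k K" for j using insert.prems that by auto
    have k: "k \<in> J" "k \<notin> K" and KJ: "K \<subseteq> J" using insert by auto
    let ?W = "\<lambda>x :: 'i \<Rightarrow> real. (\<Prod>j\<in>K. indicator (B j) (x j)) * iexp (\<Sum>j\<in>J-insert k K. a j * x j)"
    have J_K: "J - K = insert k (J - insert k K)" using k by auto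
    have component: "(\<lambda>x. x j) \<in> borel_measurable \<mu>" "(\<lambda>x. x j) \<in> borel_measurable \<nu>" if "j \<in> J" for j
      using that by (auto simp: measurable_cong_sets[OF s(1) refl] measurable_cong_sets[OF s(2) refl])
    have factor: "(\<lambda>x. indicator (B j) (x j) :: complex) \<in> borel_measurable \<mu>"
        "(\<lambda>x. indicator (B j) (x j) :: complex) \<in> borel_measurable \<nu>" if "j \<in> K" for j
      by (rule measurable_compose[OF component(1) borel_measurable_indicator]
          measurable_compose[OF component(2) borel_measurable_indicator]
          subsetD[OF KJ that] insert.prems(2) insertI2 that)+
    have iexp_borel: "iexp \<in> borel_measurable borel" by measurable
    have mW: "?W \<in> borel_measurable \<mu>" "?W \<in> borel_measurable \<nu>"
      by (rule borel_measurable_times borel_measurable_prod borel_measurable_sum borel_measurable_const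
          component factor measurable_compose[OF _ iexp_borel] | blast)+
    have nW: "norm (?W x) \<le> 1" for x
      unfolding norm_mult prod_norm[symmetric] norm_exp_i_times
      by (simp, intro prod_le_1) (auto simp: indicator_def)
    have step: "?W x * iexp (b * x k) = (\<Prod>j\<in>K. indicator (B j) (x j)) * iexp (\<Sum>j\<in>J-K. (a(k := b)) j * x j)"
      for x b
    proof -
      have "(\<Sum>j\<in>J-K. (a(k := b)) j * x j) = (\<Sum>j\<in>insert k (J-insert k K). (a(k := b)) j * x j)"
        by (rule arg_cong[where f="sum _"]) (rule J_K)
      also have "\<dots> = (a(k := b)) k * x k + (\<Sum>j\<in>J-insert k K. (a(k := b)) j * x j)"
        by (rule sum.insert) (use J in auto)
      also have "(\<Sum>j\<in>J-insert k K. (a(k := b)) j * x j) = (\<Sum>j\<in>J-insert k K. a j * x j)"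
        by (rule sum.cong) auto
      finally have "(\<Sum>j\<in>J-K. (a(k := b)) j * x j) = b * x k + (\<Sum>j\<in>J-insert k K. a j * x j)"
        by simp
      moreover have "iexp (u + v) = iexp v * iexp u" for u v :: real
        by (simp add: exp_add[symmetric] algebra_simps)
      ultimately show ?thesis by (simp only: mult.assoc)
    qed
    have "(CLINT x|\<mu>. ?W x * indicator (B k) (x k)) = (CLINT x|\<nu>. ?W x * indicator (B k) (x k))"
    proof (rule weighted_char_unique[OF \<mu> \<nu>])
      fix b
      show "(CLINT x|\<mu>. ?W x * iexp (b * x k)) = (CLINT x|\<nu>. ?W x * iexp (b * x k))"
        unfolding step by (rule insert.IH) (use insert.prems in auto)
      \<comment> \<open>the marginal law of the \<open>k\<close>-th coordinate, without weight\<close>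
      have "(\<Sum>j\<in>J. (if j = k then b else 0) * x j) = b * x k" for x :: "'i \<Rightarrow> real"
        by (simp only: sum.remove[OF J k(1)]) simp
      then show "(CLINT x|\<mu>. iexp (b * x k)) = (CLINT x|\<nu>. iexp (b * x k))"
        using eq[of "\<lambda>j. if j = k then b else 0"] by (simp only:)
    qed (rule component mW nW k(1) insertI1 insert.prems(2))+
    moreover have "p * e * i = i * p * e" for p e i :: complex by simp
    ultimately show ?case by (simp only: prod.insert[OF insert(1,2)])
  qed
  show ?thesis
  proof (rule measure_eqI_PiM_finite[OF J s])
    fix B :: "'i \<Rightarrow> real set" assume B: "\<And>i. i \<in> J \<Longrightarrow> B i \<in> sets borel"
    have [measurable]: "Pi\<^sub>E J B \<in> sets (PiM J (\<lambda>_. borel))" using J B by (rule sets_PiM_I_finite)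
    have prod: "(\<Prod>j\<in>J. indicator (B j) (x j)) = complex_of_real (indicator (Pi\<^sub>E J B) x)"
      if "x \<in> space (PiM J (\<lambda>_. borel :: real measure))" for x
      using that J by (auto simp: indicator_def space_PiM PiE_iff prod_zero_iff)
    have ind: "(CLINT x|M. \<Prod>j\<in>J. indicator (B j) (x j)) = complex_of_real (measure M (Pi\<^sub>E J B))"
      if "sets M = sets (PiM J (\<lambda>_. borel))" for M
    proof -
      have "(CLINT x|M. \<Prod>j\<in>J. indicator (B j) (x j)) = (CLINT x|M. complex_of_real (indicator (Pi\<^sub>E J B) x))"
        by (rule Bochner_Integration.integral_cong) (use prod sets_eq_imp_space_eq[OF that] in auto)
      then show ?thesis using that sets.sets_into_space[of "Pi\<^sub>E J B" M]
        by (simp add: Int_absorb2)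
    qed
    have mixed_B: "(CLINT x|\<mu>. (\<Prod>j\<in>J. indicator (B j) (x j)) * iexp (\<Sum>j\<in>J-J. 0 * x j))
        = (CLINT x|\<nu>. (\<Prod>j\<in>J. indicator (B j) (x j)) * iexp (\<Sum>j\<in>J-J. 0 * x j))"
      by (rule mixed) (use J B in auto)
    have "complex_of_real (measure \<mu> (Pi\<^sub>E J B)) = complex_of_real (measure \<nu> (Pi\<^sub>E J B))"
      using mixed_B s by (simp add: ind)
    then show "emeasure \<mu> (Pi\<^sub>E J B) = emeasure \<nu> (Pi\<^sub>E J B)"
      by (simp add: \<mu>.emeasure_eq_measure \<nu>.emeasure_eq_measure)
  next
    show "range (\<lambda>_::nat. Pi\<^sub>E J (\<lambda>_. UNIV)) \<subseteq> prod_algebra J (\<lambda>_. borel :: real measure)"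
      using J by (auto intro!: prod_algebraI_finite)
    show "(\<Union>i::nat. Pi\<^sub>E J (\<lambda>_. UNIV)) = space (PiM J (\<lambda>_. borel :: real measure))"
      by (simp add: space_PiM)
  qed auto
qed

lemma same_fddsI:
  assumes P: "prob_space P"
    and X: "\<And>t. t \<ge> 0 \<Longrightarrow> X t \<in> borel_measurable P" and Z: "\<And>t. t \<ge> 0 \<Longrightarrow> Z t \<in> borel_measurable P"
    and eq: "\<And>J a. finite J \<Longrightarrow> J \<subseteq> {0..} \<Longrightarrow>
      char (distr P borel (\<lambda>\<omega>. \<Sum>t\<in>J. a t * X t \<omega>)) 1 = char (distr P borel (\<lambda>\<omega>. \<Sum>t\<in>J. a t * Z t \<omega>)) 1"
  shows "same_fdds P X Z"
  unfolding same_fdds_def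
proof (intro allI impI)
  fix J :: "real set" assume J: "finite J" "J \<subseteq> {0..}"
  interpret prob_space P by fact
  have [measurable]: "X t \<in> borel_measurable P" "Z t \<in> borel_measurable P" if "t \<in> J" for t
    using X Z J that by auto
  have mX[measurable]: "(\<lambda>\<omega>. \<lambda>t\<in>J. X t \<omega>) \<in> measurable P (PiM J (\<lambda>_. borel))"
    by (rule measurable_restrict) simp
  have mZ[measurable]: "(\<lambda>\<omega>. \<lambda>t\<in>J. Z t \<omega>) \<in> measurable P (PiM J (\<lambda>_. borel))"
    by (rule measurable_restrict) simp
  show "fdd P X J = fdd P Z J"
  proof (rule PiM_eqI_char[OF _ _ J(1)])
    show "prob_space (fdd P X J)" "prob_space (fdd P Z J)"
      unfolding fdd_def by (auto intro!: prob_space_distr)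
    show "sets (fdd P X J) = sets (PiM J (\<lambda>_. borel))" "sets (fdd P Z J) = sets (PiM J (\<lambda>_. borel))"
      unfolding fdd_def by auto
    fix a
    have "(CLINT x|fdd P V J. iexp (\<Sum>j\<in>J. a j * x j)) = char (distr P borel (\<lambda>\<omega>. \<Sum>t\<in>J. a t * V t \<omega>)) 1"
      if [measurable]: "\<And>t. t \<in> J \<Longrightarrow> V t \<in> borel_measurable P" for V
    proof -
      have [measurable]: "(\<lambda>\<omega>. \<lambda>t\<in>J. V t \<omega>) \<in> measurable P (PiM J (\<lambda>_. borel))"
        by (rule measurable_restrict) simp
      show ?thesis unfolding fdd_def
        by (subst integral_distr) (auto simp: char_distr_eq cong: sum.cong)
    qed
    from this[of X] this[of Z] show "(CLINT x|fdd P X J. iexp (\<Sum>j\<in>J. a j * x j)) = (CLINT x|fdd P Z J. iexp (\<Sum>j\<in>J. a j * x j))"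
      using eq[OF J, of a] by auto
  qed
qed

text \<open>The map \<open>x \<mapsto> e\<^bsup>i\<theta>x\<^esup>\<close> is \<open>\<bar>\<theta>\<bar>\<close>-Lipschitz, which controls the event that \<open>X\<^sub>n\<close> and \<open>Z\<close> differ by at most
  \<open>\<epsilon>\<close>, and bounded by \<open>1\<close>, which controls the rest.\<close>

lemma char_tendsto_if_converges_in_probability:
  assumes "prob_space P" and conv: "converges_in_probability P X Z"
    and X[measurable]: "\<And>n. X n \<in> borel_measurable P" and Z[measurable]: "Z \<in> borel_measurable P"
  shows "(\<lambda>n. char (distr P borel (X n)) \<theta>) \<longlonglongrightarrow> char (distr P borel Z) \<theta>"
proof (rule LIMSEQ_I)
  interpret prob_space P by fact
  fix r :: real assume r: "0 < r"
  define \<epsilon> where "\<epsilon> = r / (2 * (\<bar>\<theta>\<bar> + 1))"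
  have \<epsilon>: "\<epsilon> > 0" using r by (auto simp: \<epsilon>_def)
  have "\<bar>\<theta>\<bar> * \<epsilon> \<le> (\<bar>\<theta>\<bar> + 1) * \<epsilon>" using \<epsilon> by (simp add: algebra_simps)
  also have "\<dots> = r / 2" by (simp add: \<epsilon>_def field_simps)
  finally have \<theta>\<epsilon>: "\<bar>\<theta>\<bar> * \<epsilon> \<le> r / 2" .
  define B where "B n = {\<omega> \<in> space P. \<bar>X n \<omega> - Z \<omega>\<bar> > \<epsilon>}" for n
  have [measurable]: "B n \<in> sets P" for n unfolding B_def by measurable
  have "(\<lambda>n. measure P (B n)) \<longlonglongrightarrow> 0"
    using conv \<epsilon> unfolding converges_in_probability_def B_def by auto
  then have "\<forall>\<^sub>F n in sequentially. measure P (B n) < r / 4"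
    by (rule order_tendstoD) (use r in auto)
  then obtain N where N: "\<And>n. n \<ge> N \<Longrightarrow> measure P (B n) < r / 4"
    by (auto simp: eventually_sequentially)
  show "\<exists>N. \<forall>n\<ge>N. norm (char (distr P borel (X n)) \<theta> - char (distr P borel Z) \<theta>) < r"
  proof (intro exI allI impI)
    fix n assume n: "n \<ge> N"
    have int: "complex_integrable P (\<lambda>\<omega>. iexp (\<theta> * V \<omega>))" if [measurable]: "V \<in> borel_measurable P" for V
      by (rule integrable_const_bound[where B=1]) auto
    have bound: "norm (iexp (\<theta> * X n \<omega>) - iexp (\<theta> * Z \<omega>)) \<le> \<bar>\<theta>\<bar> * \<epsilon> + 2 * indicator (B n) \<omega>"
      if "\<omega> \<in> space P" for \<omega>
    proof (cases "\<omega> \<in> B n")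
      case True
      have "norm (iexp (\<theta> * X n \<omega>) - iexp (\<theta> * Z \<omega>)) \<le> norm (iexp (\<theta> * X n \<omega>)) + norm (iexp (\<theta> * Z \<omega>))"
        by (rule norm_triangle_ineq4)
      also have "\<dots> = 2" by simp
      finally show ?thesis using True \<epsilon> by (simp add: add_increasing)
    next
      case False
      let ?d = "\<theta> * (X n \<omega> - Z \<omega>)"
      have "iexp (\<theta> * X n \<omega>) - iexp (\<theta> * Z \<omega>) = iexp (\<theta> * Z \<omega>) * (iexp ?d - 1)"
        by (simp add: algebra_simps exp_add[symmetric])
      then have "norm (iexp (\<theta> * X n \<omega>) - iexp (\<theta> * Z \<omega>)) = norm (iexp ?d - 1)"
        by (simp only: norm_mult norm_exp_i_times mult_1)
      also have "\<dots> \<le> \<bar>?d\<bar>"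
        using iexp_approx1[of ?d 0] by simp
      also have "\<dots> \<le> \<bar>\<theta>\<bar> * \<epsilon>"
        using False that by (auto simp: B_def abs_mult intro!: mult_left_mono)
      finally show ?thesis using False by simp
    qed
    have "norm (char (distr P borel (X n)) \<theta> - char (distr P borel Z) \<theta>)
        = norm (CLINT \<omega>|P. iexp (\<theta> * X n \<omega>) - iexp (\<theta> * Z \<omega>))"
      unfolding char_distr_eq[OF X] char_distr_eq[OF Z]
      by (subst Bochner_Integration.integral_diff[OF int[OF X] int[OF Z]]) (rule refl)
    also have "\<dots> \<le> (LINT \<omega>|P. norm (iexp (\<theta> * X n \<omega>) - iexp (\<theta> * Z \<omega>)))"
      by (rule integral_norm_bound)
    also have "\<dots> \<le> (LINT \<omega>|P. \<bar>\<theta>\<bar> * \<epsilon> + 2 * indicator (B n) \<omega>)"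
    proof (rule integral_mono[OF _ _ bound])
      show "integrable P (\<lambda>\<omega>. norm (iexp (\<theta> * X n \<omega>) - iexp (\<theta> * Z \<omega>)))"
        by (intro integrable_norm Bochner_Integration.integrable_diff int X Z)
    qed (auto intro!: integrable_real_indicator simp: emeasure_eq_measure)
    also have "\<dots> = \<bar>\<theta>\<bar> * \<epsilon> + 2 * measure P (B n)"
      by (subst Bochner_Integration.integral_add)
        (auto intro!: integrable_real_indicator simp: emeasure_eq_measure prob_space)
    also have "\<dots> < r" using \<theta>\<epsilon> N[OF n] by linarith
    finally show "norm (char (distr P borel (X n)) \<theta> - char (distr P borel Z) \<theta>) < r" .
  qed
qed

lemma char_distr_cong_AE:
  assumes "X \<in> borel_measurable P" "Z \<in> borel_measurable P" "AE \<omega> in P. X \<omega> = Z \<omega>"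
  shows "char (distr P borel X) \<theta> = char (distr P borel Z) \<theta>"
  by (subst distr_cong_AE[OF refl refl assms(3,1,2)]) (rule refl)

section \<open>Integrals of indicators against a stable random measure\<close>

locale stable_random_measure = prob_space P for P :: "'w measure" +
  fixes \<alpha> :: real and m :: "'b measure" and M :: "'b set \<Rightarrow> 'w \<Rightarrow> real"
  assumes \<alpha>_pos: "0 < \<alpha>" and random_measure: "SaS_random_measure P \<alpha> m M"
begin

lemma borel_measurable_M[measurable]: "A \<in> finite_measure_sets m \<Longrightarrow> M A \<in> borel_measurable P"
  using random_measure by (auto simp: SaS_random_measure_def has_SaS_law_def)

lemma char_M:
  assumes "A \<in> finite_measure_sets m"
  shows "char (distr P borel (M A)) \<theta> = complex_of_real (exp (- measure m A * \<bar>\<theta>\<bar> powr \<alpha>))"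
proof -
  have "(measure m A powr (1 / \<alpha>)) powr \<alpha> = measure m A"
    using \<alpha>_pos by (simp add: powr_powr)
  then show ?thesis
    using random_measure assms by (auto simp: SaS_random_measure_def has_SaS_law_def)
qed

lemma finite_measure_sets_empty[simp]: "{} \<in> finite_measure_sets m"
  by (simp add: finite_measure_sets_def)

lemma AE_M_empty: "AE \<omega> in P. M {} \<omega> = 0"
proof (rule AE_zero_if_char_one)
  show "prob_space P" by unfold_locales
qed (use char_M[of "{}"] in simp_all)

lemma AE_M_finite_Union:
  assumes "finite I" "\<And>i. i \<in> I \<Longrightarrow> C i \<in> finite_measure_sets m" "disjoint_family_on C I"
  shows "AE \<omega> in P. M (\<Union>i\<in>I. C i) \<omega> = (\<Sum>i\<in>I. M (C i) \<omega>)"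
proof -
  obtain f and n :: nat where f: "bij_betw f {..<n} I"
    using ex_bij_betw_nat_finite[OF assms(1)] by (auto simp: atLeast0LessThan)
  have fI: "f k \<in> I" if "k < n" for k using f that by (auto simp: bij_betw_def)
  have fC: "C (f k) \<inter> C (f l) = {}" if "k < n" "l < n" "k \<noteq> l" for k l
  proof (rule disjoint_family_onD[OF assms(3) fI[OF that(1)] fI[OF that(2)]])
    show "f k \<noteq> f l" using f that by (auto simp: bij_betw_def inj_on_def)
  qed
  \<comment> \<open>the sequence is padded with empty sets, on which \<open>M\<close> vanishes almost surely\<close>
  define A where "A k = (if k < n then C (f k) else {})" for k
  have A: "A k \<in> finite_measure_sets m" for k using assms(2) fI by (auto simp: A_def)
  have dA: "disjoint_family A"
    using fC by (auto simp: disjoint_family_on_def A_def)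
  have U: "(\<Union>k. A k) = (\<Union>i\<in>I. C i)"
    using f by (auto simp: A_def bij_betw_def split: if_splits)
  have "(\<Union>i\<in>I. C i) \<in> sets m" using assms by (auto simp: finite_measure_sets_def)
  moreover have "emeasure m (\<Union>i\<in>I. C i) \<le> (\<Sum>i\<in>I. emeasure m (C i))"
    by (rule emeasure_subadditive_finite) (use assms in \<open>auto simp: finite_measure_sets_def\<close>)
  moreover have "(\<Sum>i\<in>I. emeasure m (C i)) < \<infinity>"
    using assms by (auto simp: finite_measure_sets_def)
  ultimately have "(\<Union>i\<in>I. C i) \<in> finite_measure_sets m"
    by (auto simp: finite_measure_sets_def)
  then have "AE \<omega> in P. (\<lambda>k. M (A k) \<omega>) sums M (\<Union>k. A k) \<omega>"
    using random_measure dA A unfolding SaS_random_measure_def U[symmetric] by blast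
  with AE_M_empty show ?thesis
  proof eventually_elim
    case (elim \<omega>)
    have "(\<lambda>k. M (A k) \<omega>) sums (\<Sum>k<n. M (A k) \<omega>)"
      by (rule sums_finite) (use elim(1) in \<open>auto simp: A_def\<close>)
    then have "M (\<Union>k. A k) \<omega> = (\<Sum>k<n. M (A k) \<omega>)"
      using elim(2) by (rule sums_unique2[symmetric])
    also have "\<dots> = (\<Sum>k<n. M (C (f k)) \<omega>)" by (simp add: A_def)
    also have "\<dots> = (\<Sum>i\<in>I. M (C i) \<omega>)" by (rule sum.reindex_bij_betw[OF f])
    finally show ?case unfolding U .
  qed
qed

lemma char_sum_M_disjoint:
  assumes "finite I" "\<And>i. i \<in> I \<Longrightarrow> C i \<in> finite_measure_sets m" "disjoint_family_on C I"
  shows "char (distr P borel (\<lambda>\<omega>. \<Sum>i\<in>I. c i * M (C i) \<omega>)) \<theta>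
    = complex_of_real (exp (- (\<Sum>i\<in>I. \<bar>c i\<bar> powr \<alpha> * measure m (C i)) * \<bar>\<theta>\<bar> powr \<alpha>))"
proof -
  obtain f and n :: nat where f: "bij_betw f {..<n} I"
    using ex_bij_betw_nat_finite[OF assms(1)] by (auto simp: atLeast0LessThan)
  have fI: "f k \<in> I" if "k < n" for k using f that by (auto simp: bij_betw_def)
  have fC: "C (f k) \<inter> C (f l) = {}" if "k < n" "l < n" "k \<noteq> l" for k l
  proof (rule disjoint_family_onD[OF assms(3) fI[OF that(1)] fI[OF that(2)]])
    show "f k \<noteq> f l" using f that by (auto simp: bij_betw_def inj_on_def)
  qed
  have "disjoint_family_on (\<lambda>k. C (f k)) {..<n}"
    using fC by (auto simp: disjoint_family_on_def)
  moreover have "(\<lambda>k. C (f k)) ` {..<n} \<subseteq> finite_measure_sets m" using assms(2) fI by auto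
  ultimately have "indep_vars (\<lambda>_. borel) (\<lambda>k. M (C (f k))) {..<n}"
    using random_measure unfolding SaS_random_measure_def by blast
  then have indep: "indep_vars (\<lambda>_. borel) (\<lambda>k \<omega>. c (f k) * M (C (f k)) \<omega>) {..<n}"
    by (rule indep_vars_compose2) auto
  have char1: "char (distr P borel (\<lambda>\<omega>. c i * M (C i) \<omega>)) \<theta>
      = complex_of_real (exp (- (\<bar>c i\<bar> powr \<alpha> * measure m (C i)) * \<bar>\<theta>\<bar> powr \<alpha>))" if "i \<in> I" for i
  proof -
    note [measurable] = borel_measurable_M[OF assms(2)[OF that]]
    have "char (distr P borel (\<lambda>\<omega>. c i * M (C i) \<omega>)) \<theta> = char (distr P borel (M (C i))) (c i * \<theta>)"
      by (subst (1 2) char_distr_eq) (simp_all add: mult_ac)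
    then show ?thesis
      by (simp add: char_M[OF assms(2)[OF that]] abs_mult powr_mult mult_ac)
  qed
  have "(\<lambda>\<omega>. \<Sum>i\<in>I. c i * M (C i) \<omega>) = (\<lambda>\<omega>. \<Sum>k<n. c (f k) * M (C (f k)) \<omega>)"
    by (rule ext) (rule sum.reindex_bij_betw[OF f, symmetric])
  then have "char (distr P borel (\<lambda>\<omega>. \<Sum>i\<in>I. c i * M (C i) \<omega>)) \<theta>
      = (\<Prod>k<n. char (distr P borel (\<lambda>\<omega>. c (f k) * M (C (f k)) \<omega>)) \<theta>)"
    by (simp only: char_distr_sum[OF indep])
  also have "\<dots> = (\<Prod>i\<in>I. char (distr P borel (\<lambda>\<omega>. c i * M (C i) \<omega>)) \<theta>)"
    by (rule prod.reindex_bij_betw[OF f])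
  also have "\<dots> = (\<Prod>i\<in>I. complex_of_real (exp (- (\<bar>c i\<bar> powr \<alpha> * measure m (C i)) * \<bar>\<theta>\<bar> powr \<alpha>)))"
    by (rule prod.cong[OF refl char1])
  also have "\<dots> = complex_of_real (exp (\<Sum>i\<in>I. - (\<bar>c i\<bar> powr \<alpha> * measure m (C i)) * \<bar>\<theta>\<bar> powr \<alpha>))"
    by (simp only: exp_sum[OF assms(1)] of_real_prod)
  also have "(\<Sum>i\<in>I. - (\<bar>c i\<bar> powr \<alpha> * measure m (C i)) * \<bar>\<theta>\<bar> powr \<alpha>)
      = - (\<Sum>i\<in>I. \<bar>c i\<bar> powr \<alpha> * measure m (C i)) * \<bar>\<theta>\<bar> powr \<alpha>"
    by (simp only: sum_distrib_right[symmetric] sum_negf)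
  finally show ?thesis .
qed

text \<open>The sets \<open>E\<^sub>i\<close> may overlap. They are unions of the atoms \<open>C\<^sub>S\<close>, the points lying in exactly the sets
  \<open>E\<^sub>i\<close> with \<open>i \<in> S\<close>; on \<open>C\<^sub>S\<close> the function \<open>\<Sum> a\<^sub>i 1\<^bsub>E\<^sub>i\<^esub>\<close> has the constant value \<open>c\<^sub>S\<close>. Regrouping the sum by
  atoms reduces the claim to disjoint sets.\<close>

lemma char_sum_M:
  assumes I: "finite I" and E: "\<And>i. i \<in> I \<Longrightarrow> E i \<in> finite_measure_sets m"
  shows "char (distr P borel (\<lambda>\<omega>. \<Sum>i\<in>I. a i * M (E i) \<omega>)) \<theta>
    = complex_of_real (exp (- (\<integral>x. \<bar>\<Sum>i\<in>I. a i * indicator (E i) x\<bar> powr \<alpha> \<partial>m) * \<bar>\<theta>\<bar> powr \<alpha>))"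
proof -
  define C where "C S = {x \<in> space m. {i \<in> I. x \<in> E i} = S}" for S
  define c where "c S = (\<Sum>i\<in>S. a i)" for S
  \<comment> \<open>the atom of the empty index set may have infinite measure and must be left out\<close>
  define T where "T = Pow I - {{}}"
  have T: "finite T" using I by (simp add: T_def)
  have [measurable]: "E i \<in> sets m" if "i \<in> I" for i using E that by (auto simp: finite_measure_sets_def)
  have Esub: "E i \<subseteq> space m" if "i \<in> I" for i by (rule sets.sets_into_space) (use that in simp)
  have C: "C S \<in> finite_measure_sets m" if S: "S \<in> T" for S
  proof -
    have "C S = {x \<in> space m. \<forall>i\<in>I. x \<in> E i \<longleftrightarrow> i \<in> S}"
      using that by (auto simp: C_def T_def)
    also have "\<dots> \<in> sets m" using I by measurable
    finally have "C S \<in> sets m" .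
    moreover obtain i where i: "i \<in> S" "i \<in> I" using S by (auto simp: T_def)
    have "emeasure m (C S) \<le> emeasure m (E i)"
      by (rule emeasure_mono) (use i in \<open>auto simp: C_def\<close>)
    ultimately show ?thesis using E[OF i(2)] by (auto simp: finite_measure_sets_def)
  qed
  have disj: "disjoint_family_on C T" by (auto simp: disjoint_family_on_def C_def)
  have EC: "E i = (\<Union>S\<in>{S \<in> T. i \<in> S}. C S)" if "i \<in> I" for i
    using Esub[OF that] that by (auto simp: C_def T_def)
  have "AE \<omega> in P. \<forall>i\<in>I. M (E i) \<omega> = (\<Sum>S\<in>{S \<in> T. i \<in> S}. M (C S) \<omega>)"
  proof (rule AE_finite_allI[OF I])
    fix i assume i: "i \<in> I"
    show "AE \<omega> in P. M (E i) \<omega> = (\<Sum>S\<in>{S \<in> T. i \<in> S}. M (C S) \<omega>)"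
      by (subst EC[OF i], rule AE_M_finite_Union)
        (use T C disj in \<open>auto simp: disjoint_family_on_def\<close>)
  qed
  then have "AE \<omega> in P. (\<Sum>i\<in>I. a i * M (E i) \<omega>) = (\<Sum>S\<in>T. c S * M (C S) \<omega>)"
  proof eventually_elim
    case (elim \<omega>)
    have "(\<Sum>i\<in>I. a i * M (E i) \<omega>) = (\<Sum>i\<in>I. \<Sum>S\<in>{S \<in> T. i \<in> S}. a i * M (C S) \<omega>)"
      by (rule sum.cong[OF refl]) (use elim in \<open>simp add: sum_distrib_left\<close>)
    also have "\<dots> = (\<Sum>S\<in>T. \<Sum>i\<in>{i \<in> I. i \<in> S}. a i * M (C S) \<omega>)"
      by (rule sum.swap_restrict[OF I T])
    also have "\<dots> = (\<Sum>S\<in>T. c S * M (C S) \<omega>)"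
    proof (rule sum.cong[OF refl])
      fix S assume "S \<in> T"
      then have "{i \<in> I. i \<in> S} = S" by (auto simp: T_def)
      then show "(\<Sum>i\<in>{i \<in> I. i \<in> S}. a i * M (C S) \<omega>) = c S * M (C S) \<omega>"
        by (simp add: c_def sum_distrib_right)
    qed
    finally show ?case .
  qed
  then have "char (distr P borel (\<lambda>\<omega>. \<Sum>i\<in>I. a i * M (E i) \<omega>)) \<theta>
      = char (distr P borel (\<lambda>\<omega>. \<Sum>S\<in>T. c S * M (C S) \<omega>)) \<theta>"
    by (intro char_distr_cong_AE borel_measurable_sum borel_measurable_times borel_measurable_const
        borel_measurable_M E C)
  also have "\<dots> = complex_of_real (exp (- (\<Sum>S\<in>T. \<bar>c S\<bar> powr \<alpha> * measure m (C S)) * \<bar>\<theta>\<bar> powr \<alpha>))"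
    by (rule char_sum_M_disjoint[OF T C disj])
  also have "(\<Sum>S\<in>T. \<bar>c S\<bar> powr \<alpha> * measure m (C S))
      = (\<Sum>S\<in>T. \<integral>x. \<bar>c S\<bar> powr \<alpha> * indicator (C S) x \<partial>m)"
  proof (rule sum.cong[OF refl])
    fix S assume "S \<in> T"
    then have "C S \<in> sets m" using C by (auto simp: finite_measure_sets_def)
    then show "\<bar>c S\<bar> powr \<alpha> * measure m (C S) = (\<integral>x. \<bar>c S\<bar> powr \<alpha> * indicator (C S) x \<partial>m)"
      by (simp add: Int_absorb2 sets.sets_into_space)
  qed
  also have "\<dots> = (\<integral>x. (\<Sum>S\<in>T. \<bar>c S\<bar> powr \<alpha> * indicator (C S) x) \<partial>m)"
    by (rule Bochner_Integration.integral_sum[symmetric])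
      (use C in \<open>auto simp: finite_measure_sets_def intro!: integrable_mult_right integrable_real_indicator\<close>)
  also have "\<dots> = (\<integral>x. \<bar>\<Sum>i\<in>I. a i * indicator (E i) x\<bar> powr \<alpha> \<partial>m)"
  proof (rule Bochner_Integration.integral_cong[OF refl])
    fix x assume x: "x \<in> space m"
    define S where "S = {i \<in> I. x \<in> E i}"
    have a: "(\<Sum>i\<in>I. a i * indicator (E i) x) = c S"
      unfolding c_def S_def indicator_def using I by (intro sum.mono_neutral_cong_right) auto
    have "(\<Sum>R\<in>T. \<bar>c R\<bar> powr \<alpha> * indicator (C R) x) = (\<Sum>R\<in>T. if R = S then \<bar>c S\<bar> powr \<alpha> else 0)"
      by (rule sum.cong[OF refl]) (use x in \<open>auto simp: C_def S_def\<close>)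
    also have "\<dots> = (if S \<in> T then \<bar>c S\<bar> powr \<alpha> else 0)"
      using T by simp
    also have "\<dots> = \<bar>c S\<bar> powr \<alpha>"
    proof (cases "S = {}")
      case True
      then show ?thesis by (simp add: T_def c_def)
    next
      case False
      then show ?thesis by (auto simp: T_def S_def)
    qed
    finally show "(\<Sum>R\<in>T. \<bar>c R\<bar> powr \<alpha> * indicator (C R) x) = \<bar>\<Sum>i\<in>I. a i * indicator (E i) x\<bar> powr \<alpha>"
      unfolding a .
  qed
  finally show ?thesis .
qed

text \<open>Markov's inequality: \<open>\<bar>s\<bar>\<^sup>\<alpha>\<close> equals the positive constant \<open>\<bar>y\<bar>\<^sup>\<alpha>\<close> on the level set.\<close>

lemma level_set_finite_measure:
  assumes s: "simple_function m s" "s \<in> L_space \<alpha> m" and y: "y \<noteq> 0"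
  shows "s -` {y} \<inter> space m \<in> finite_measure_sets m"
proof -
  let ?A = "s -` {y} \<inter> space m"
  have A: "?A \<in> sets m" using s(1) by (rule simple_functionD)
  have "integrable m (\<lambda>x. \<bar>s x\<bar> powr \<alpha> * (1 / \<bar>y\<bar> powr \<alpha>))"
    using s(2) unfolding L_space_def by (intro integrable_mult_left) auto
  then have "integrable m (indicator ?A :: _ \<Rightarrow> real)"
    by (rule Bochner_Integration.integrable_bound)
      (use A y in \<open>auto simp: indicator_def\<close>)
  then show ?thesis using A by (auto simp: finite_measure_sets_def integrable_indicator_iff Int_absorb2)
qed

lemma borel_measurable_simple_stable_integral:
  assumes s: "simple_function m s" "s \<in> L_space \<alpha> m"
  shows "simple_stable_integral m M s \<in> borel_measurable P"
  unfolding simple_stable_integral_def[abs_def]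
  by (intro borel_measurable_sum borel_measurable_times borel_measurable_const borel_measurable_M
      level_set_finite_measure[OF s]) auto

text \<open>The integral of \<open>s\<close> is itself a linear combination of values of \<open>M\<close>, so the difference is one with an
  additional term \<open>-1 \<cdot> M(E)\<close>. The index type \<open>real option\<close> combines the nonzero values of \<open>s\<close> with the
  index \<open>None\<close> of that term; thus the level sets and \<open>E\<close> may overlap freely.\<close>

lemma char_simple_stable_integral_diff:
  assumes s: "simple_function m s" "s \<in> L_space \<alpha> m" and E: "E \<in> finite_measure_sets m"
  shows "char (distr P borel (\<lambda>\<omega>. simple_stable_integral m M s \<omega> - M E \<omega>)) \<theta>
    = complex_of_real (exp (- (\<integral>x. \<bar>s x - indicator E x\<bar> powr \<alpha> \<partial>m) * \<bar>\<theta>\<bar> powr \<alpha>))"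
proof -
  define R where "R = s ` space m - {0}"
  have R: "finite R" using s(1) by (simp add: R_def simple_functionD)
  define F where "F j = (case j of None \<Rightarrow> E | Some y \<Rightarrow> s -` {y} \<inter> space m)" for j
  define a :: "real option \<Rightarrow> real" where "a j = (case j of None \<Rightarrow> - 1 | Some y \<Rightarrow> y)" for j
  define I where "I = insert None (Some ` R)"
  have I: "finite I" using R by (simp add: I_def)
  have F: "F j \<in> finite_measure_sets m" if "j \<in> I" for j
  proof (cases j)
    case None
    then show ?thesis using E by (simp add: F_def)
  next
    case (Some y)
    then have "y \<noteq> 0" using that by (auto simp: I_def R_def)
    then show ?thesis using level_set_finite_measure[OF s] Some by (simp add: F_def)
  qed
  have split: "(\<Sum>j\<in>I. a j * g (F j)) = (\<Sum>y\<in>R. y * g (s -` {y} \<inter> space m)) - g E"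
    for g :: "'b set \<Rightarrow> real"
    unfolding I_def using R by (subst sum.insert) (auto simp: sum.reindex a_def F_def)
  have "(\<lambda>\<omega>. simple_stable_integral m M s \<omega> - M E \<omega>) = (\<lambda>\<omega>. \<Sum>j\<in>I. a j * M (F j) \<omega>)"
    using split[of "\<lambda>A. M A \<omega>" for \<omega>] by (simp add: simple_stable_integral_def R_def)
  then have "char (distr P borel (\<lambda>\<omega>. simple_stable_integral m M s \<omega> - M E \<omega>)) \<theta>
      = complex_of_real (exp (- (\<integral>x. \<bar>\<Sum>j\<in>I. a j * indicator (F j) x\<bar> powr \<alpha> \<partial>m) * \<bar>\<theta>\<bar> powr \<alpha>))"
    by (simp only: char_sum_M[OF I F])
  also have "(\<integral>x. \<bar>\<Sum>j\<in>I. a j * indicator (F j) x\<bar> powr \<alpha> \<partial>m) = (\<integral>x. \<bar>s x - indicator E x\<bar> powr \<alpha> \<partial>m)"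
  proof (rule Bochner_Integration.integral_cong[OF refl])
    fix x assume x: "x \<in> space m"
    have "(\<Sum>y\<in>R. y * indicator (s -` {y} \<inter> space m) x) = (\<Sum>y\<in>R. if y = s x then s x else 0)"
      by (rule sum.cong[OF refl]) (use x in auto)
    also have "\<dots> = s x" using R x by (auto simp: R_def)
    finally show "\<bar>\<Sum>j\<in>I. a j * indicator (F j) x\<bar> powr \<alpha> = \<bar>s x - indicator E x\<bar> powr \<alpha>"
      using split[of "\<lambda>A. indicator A x"] by simp
  qed
  finally show ?thesis .
qed

text \<open>Let \<open>s\<^sub>n\<close> approximate the indicator of \<open>E\<close>. The characteristic function of \<open>\<integral> s\<^sub>n dM - M(E)\<close> tends to
  that of \<open>X - M(E)\<close>, by convergence in probability, and to \<open>1\<close>, because its exponent is the \<open>L\<^sup>\<alpha>\<close> distance of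
  \<open>s\<^sub>n\<close> from the indicator. A variable with characteristic function \<open>1\<close> is almost surely \<open>0\<close>.\<close>

lemma stable_integral_indicator_AE:
  assumes int: "has_stable_integral P \<alpha> m M f X"
    and f: "\<And>x. x \<in> space m \<Longrightarrow> f x = indicator E x" and E: "E \<in> finite_measure_sets m"
  shows "AE \<omega> in P. X \<omega> = M E \<omega>"
proof -
  from int have X[measurable]: "X \<in> borel_measurable P" by (simp add: has_stable_integral_def)
  from int obtain s where s: "\<And>n. simple_function m (s n)" "\<And>n. s n \<in> L_space \<alpha> m"
    and lim: "(\<lambda>n. \<integral>x. \<bar>s n x - f x\<bar> powr \<alpha> \<partial>m) \<longlonglongrightarrow> 0"
    and conv: "converges_in_probability P (\<lambda>n. simple_stable_integral m M (s n)) X"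
    unfolding has_stable_integral_def by blast
  note [measurable] = borel_measurable_simple_stable_integral[OF s] borel_measurable_M[OF E]
  have lim': "(\<lambda>n. \<integral>x. \<bar>s n x - indicator E x\<bar> powr \<alpha> \<partial>m) \<longlonglongrightarrow> 0"
    using lim by (simp add: f cong: Bochner_Integration.integral_cong)
  have "AE \<omega> in P. X \<omega> - M E \<omega> = 0"
  proof (rule AE_zero_if_char_one)
    show "prob_space P" by unfold_locales
    fix \<theta>
    have "converges_in_probability P (\<lambda>n \<omega>. simple_stable_integral m M (s n) \<omega> - M E \<omega>) (\<lambda>\<omega>. X \<omega> - M E \<omega>)"
      using conv by (simp add: converges_in_probability_def)
    then have "(\<lambda>n. char (distr P borel (\<lambda>\<omega>. simple_stable_integral m M (s n) \<omega> - M E \<omega>)) \<theta>)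
        \<longlonglongrightarrow> char (distr P borel (\<lambda>\<omega>. X \<omega> - M E \<omega>)) \<theta>"
      by (rule char_tendsto_if_converges_in_probability[rotated]) (auto, unfold_locales)
    moreover have "(\<lambda>n. char (distr P borel (\<lambda>\<omega>. simple_stable_integral m M (s n) \<omega> - M E \<omega>)) \<theta>)
        \<longlonglongrightarrow> complex_of_real (exp (- 0 * \<bar>\<theta>\<bar> powr \<alpha>))"
      unfolding char_simple_stable_integral_diff[OF s E] by (intro tendsto_intros lim')
    ultimately show "char (distr P borel (\<lambda>\<omega>. X \<omega> - M E \<omega>)) \<theta> = 1"
      using LIMSEQ_unique by fastforce
  qed auto
  then show ?thesis by eventually_elim simp
qed

lemma indicator_in_L_space:
  assumes f: "\<And>x. x \<in> space m \<Longrightarrow> f x = indicator E x" and E: "E \<in> finite_measure_sets m"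
  shows "f \<in> L_space \<alpha> m"
proof -
  have "(\<lambda>x. indicator E x :: real) \<in> L_space \<alpha> m"
  proof -
    have "(\<lambda>x. \<bar>indicator E x :: real\<bar> powr \<alpha>) = indicator E" by (auto simp: indicator_def)
    then show ?thesis using E by (auto simp: L_space_def finite_measure_sets_def intro!: integrable_real_indicator)
  qed
  then show ?thesis
    by (simp add: L_space_def f cong: measurable_cong Bochner_Integration.integrable_cong)
qed

lemma stable_integral_indicator_exists:
  assumes f: "\<And>x. x \<in> space m \<Longrightarrow> f x = indicator E x" and E: "E \<in> finite_measure_sets m"
  shows "\<exists>X. has_stable_integral P \<alpha> m M f X"
proof -
  have "simple_function m (indicator E :: _ \<Rightarrow> real)"
    using E by (auto simp: finite_measure_sets_def)
  then have s: "simple_function m f" using f by (simp cong: simple_function_cong)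
  have L: "f \<in> L_space \<alpha> m" using f E by (rule indicator_in_L_space)
  have "has_stable_integral P \<alpha> m M f (simple_stable_integral m M f)"
    unfolding has_stable_integral_def
    using s L borel_measurable_simple_stable_integral[OF s L]
    by (auto simp: converges_in_probability_def intro!: exI[of _ "\<lambda>_. f"])
  then show ?thesis by blast
qed

lemma char_sum_stable_integrals:
  assumes I: "finite I" and E: "\<And>i. i \<in> I \<Longrightarrow> E i \<in> finite_measure_sets m"
    and f: "\<And>i x. i \<in> I \<Longrightarrow> x \<in> space m \<Longrightarrow> f i x = indicator (E i) x"
    and Y: "\<And>i. i \<in> I \<Longrightarrow> has_stable_integral P \<alpha> m M (f i) (Y i)"
  shows "char (distr P borel (\<lambda>\<omega>. \<Sum>i\<in>I. a i * Y i \<omega>)) \<theta>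
    = complex_of_real (exp (- (\<integral>x. \<bar>\<Sum>i\<in>I. a i * f i x\<bar> powr \<alpha> \<partial>m) * \<bar>\<theta>\<bar> powr \<alpha>))"
proof -
  have "Y i \<in> borel_measurable P" if "i \<in> I" for i
    using Y[OF that] by (simp add: has_stable_integral_def)
  moreover have "AE \<omega> in P. \<forall>i\<in>I. Y i \<omega> = M (E i) \<omega>"
    by (rule AE_finite_allI[OF I]) (rule stable_integral_indicator_AE[OF Y f E])
  then have "AE \<omega> in P. (\<Sum>i\<in>I. a i * Y i \<omega>) = (\<Sum>i\<in>I. a i * M (E i) \<omega>)"
    by eventually_elim simp
  ultimately have "char (distr P borel (\<lambda>\<omega>. \<Sum>i\<in>I. a i * Y i \<omega>)) \<theta>
      = char (distr P borel (\<lambda>\<omega>. \<Sum>i\<in>I. a i * M (E i) \<omega>)) \<theta>"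
    by (intro char_distr_cong_AE borel_measurable_sum borel_measurable_times borel_measurable_const
        borel_measurable_M E)
  also have "\<dots> = complex_of_real (exp (- (\<integral>x. \<bar>\<Sum>i\<in>I. a i * indicator (E i) x\<bar> powr \<alpha> \<partial>m) * \<bar>\<theta>\<bar> powr \<alpha>))"
    by (rule char_sum_M[OF I E])
  also have "(\<integral>x. \<bar>\<Sum>i\<in>I. a i * indicator (E i) x\<bar> powr \<alpha> \<partial>m) = (\<integral>x. \<bar>\<Sum>i\<in>I. a i * f i x\<bar> powr \<alpha> \<partial>m)"
    by (rule Bochner_Integration.integral_cong) (auto simp: f)
  finally show ?thesis .
qed

end

section \<open>Stable variables of index greater than one are integrable\<close>

text \<open>For \<open>\<bar>x\<bar> > 1\<close> choose \<open>k\<close> with \<open>1/2 < \<bar>x\<bar> / 2\<^sup>k \<le> 1\<close>; on this range the cosine is at most \<open>cos(1/2)\<close>.\<close>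

lemma abs_le_dyadic_one_minus_cos:
  fixes x :: real
  assumes "1 < \<bar>x\<bar>"
  obtains k :: nat where "(1 - cos (1/2)) * \<bar>x\<bar> \<le> 2 ^ k * (1 - cos (x / 2 ^ k))"
proof -
  have "\<exists>n::nat. \<bar>x\<bar> \<le> 2 ^ n" using real_arch_pow[of 2 "\<bar>x\<bar>"] by (auto intro: less_imp_le)
  then obtain n :: nat where n: "\<bar>x\<bar> \<le> 2 ^ n" and min: "\<And>l. l < n \<Longrightarrow> \<not> \<bar>x\<bar> \<le> 2 ^ l"
    unfolding exists_least_iff[of "\<lambda>n. \<bar>x\<bar> \<le> 2 ^ n"] by auto
  have "n \<noteq> 0" using n assms by (intro notI) simp
  then have "2 ^ n < 2 * \<bar>x\<bar>" using min[of "n - 1"] by (cases n) auto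
  then have u: "1/2 \<le> \<bar>x\<bar> / 2 ^ n" "\<bar>x\<bar> / 2 ^ n \<le> 1" using n by (simp_all add: field_simps)
  have "cos (x / 2 ^ n) = cos (\<bar>x\<bar> / 2 ^ n)"
    by (cases "x \<ge> 0") auto
  also have "\<dots> \<le> cos (1/2)"
    by (rule cos_monotone_0_pi_le) (use u pi_ge_two in linarith)+
  finally have "1 - cos (1/2) \<le> 1 - cos (x / 2 ^ n)" by simp
  then have "2 ^ n * (1 - cos (1/2)) \<le> 2 ^ n * (1 - cos (x / 2 ^ n))"
    by (intro mult_left_mono) auto
  moreover have "(1 - cos (1/2)) * \<bar>x\<bar> \<le> (1 - cos (1/2)) * 2 ^ n"
    by (intro mult_left_mono n) auto
  ultimately have "(1 - cos (1/2)) * \<bar>x\<bar> \<le> 2 ^ n * (1 - cos (x / 2 ^ n))" by argo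
  then show thesis by (rule that)
qed

text \<open>By the previous lemma \<open>\<bar>X\<bar>\<close> is bounded by a constant plus a multiple of the series
  \<open>\<Sum>\<^sub>k 2\<^sup>k (1 - cos(X / 2\<^sup>k))\<close>. The expectation of the \<open>k\<close>-th term is \<open>2\<^sup>k (1 - \<phi>(2\<^sup>-\<^sup>k)) \<le> \<sigma>\<^sup>\<beta> 2\<^bsup>k(1-\<beta>)\<^esup>\<close>, where \<open>\<phi>\<close> is the
  characteristic function of \<open>X\<close>, and for \<open>\<beta> > 1\<close> these bounds form a convergent geometric series.\<close>

lemma integrable_SaS_law:
  assumes "prob_space P" and law: "has_SaS_law P \<beta> \<sigma> X" and \<beta>: "1 < \<beta>"
  shows "integrable P X"
proof -
  interpret prob_space P by fact
  from law have X[measurable]: "X \<in> borel_measurable P" by (simp add: has_SaS_law_def)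
  define c\<^sub>0 :: real where "c\<^sub>0 = 1 - cos (1/2)"
  have "cos (1/2) < cos (0::real)" by (rule cos_monotone_0_pi) (use pi_ge_two in auto)
  then have c0: "c\<^sub>0 > 0" by (simp add: c\<^sub>0_def)
  define g where "g k x = 2 ^ k * (1 - cos (x / 2 ^ k))" for k :: nat and x :: real
  have g0: "0 \<le> g k x" for k x by (simp add: g_def)
  have [measurable]: "g k \<in> borel_measurable borel" for k unfolding g_def by measurable
  define r where "r = 2 powr (1 - \<beta>)"
  have r: "0 < r" "r < 1" using \<beta> by (auto simp: r_def powr_less_one)
  have expect: "(\<integral>\<^sup>+\<omega>. ennreal (g k (X \<omega>)) \<partial>P) \<le> ennreal (\<sigma> powr \<beta> * r ^ k)" for k
  proof -
    define \<theta> :: real where "\<theta> = 1 / 2 ^ k"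
    have \<theta>: "\<theta> > 0" by (simp add: \<theta>_def)
    have i: "complex_integrable P (\<lambda>\<omega>. iexp (\<theta> * X \<omega>))"
      by (rule integrable_const_bound[where B=1]) auto
    have "(LINT \<omega>|P. cos (\<theta> * X \<omega>)) = (LINT \<omega>|P. Re (iexp (\<theta> * X \<omega>)))"
      by (simp add: exp_eq_polar flip: of_real_mult)
    also have "\<dots> = Re (char (distr P borel X) \<theta>)"
      unfolding char_distr_eq[OF X] by (rule integral_Re[OF i])
    also have "\<dots> = exp (- (\<sigma> powr \<beta>) * \<theta> powr \<beta>)"
      using law \<theta> by (simp add: has_SaS_law_def)
    finally have cos: "(LINT \<omega>|P. cos (\<theta> * X \<omega>)) = exp (- (\<sigma> powr \<beta>) * \<theta> powr \<beta>)" .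
    have icos: "integrable P (\<lambda>\<omega>. cos (\<theta> * X \<omega>))"
      by (rule integrable_const_bound[where B=1]) auto
    have "(\<integral>\<^sup>+\<omega>. ennreal (g k (X \<omega>)) \<partial>P) = ennreal (LINT \<omega>|P. g k (X \<omega>))"
    proof (rule nn_integral_eq_integral)
      have "integrable P (\<lambda>\<omega>. 2 ^ k * (1 - cos (\<theta> * X \<omega>)))"
        using icos by auto
      then show "integrable P (\<lambda>\<omega>. g k (X \<omega>))" by (simp add: g_def \<theta>_def)
    qed (use g0 in auto)
    also have "(LINT \<omega>|P. g k (X \<omega>)) = (LINT \<omega>|P. 2 ^ k * (1 - cos (\<theta> * X \<omega>)))"
      by (simp add: g_def \<theta>_def)
    also have "\<dots> = 2 ^ k * (1 - exp (- (\<sigma> powr \<beta>) * \<theta> powr \<beta>))"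
      using icos by (simp add: cos prob_space)
    also have "\<dots> \<le> 2 ^ k * (\<sigma> powr \<beta> * \<theta> powr \<beta>)"
      using exp_ge_add_one_self[of "- (\<sigma> powr \<beta>) * \<theta> powr \<beta>"] by (intro mult_left_mono) auto
    also have "\<dots> = \<sigma> powr \<beta> * r ^ k"
    proof -
      have "\<theta> powr \<beta> = 2 powr (- (real k * \<beta>))"
        by (simp add: \<theta>_def powr_realpow[symmetric] powr_divide powr_powr powr_minus_divide)
      moreover have "(2::real) ^ k = 2 powr real k" by (simp add: powr_realpow)
      moreover have "r ^ k = 2 powr (real k - real k * \<beta>)"
        unfolding powr_realpow[OF r(1), symmetric] by (simp add: r_def powr_powr algebra_simps)
      ultimately show ?thesis by (simp add: powr_add[symmetric])
    qed
    finally show ?thesis by (simp add: ennreal_leI)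
  qed
  have "(\<integral>\<^sup>+\<omega>. (\<Sum>k. ennreal (g k (X \<omega>))) \<partial>P) = (\<Sum>k. \<integral>\<^sup>+\<omega>. ennreal (g k (X \<omega>)) \<partial>P)"
    by (rule nn_integral_suminf) measurable
  also have "\<dots> \<le> (\<Sum>k. ennreal (\<sigma> powr \<beta> * r ^ k))"
    by (intro suminf_le expect) auto
  also have "\<dots> < \<infinity>"
    unfolding infinity_ennreal_def less_top[symmetric]
    by (rule ennreal_suminf_neq_top) (use r in \<open>auto intro!: summable_mult summable_geometric\<close>)
  finally have fin: "(\<integral>\<^sup>+\<omega>. (\<Sum>k. ennreal (g k (X \<omega>))) \<partial>P) < \<infinity>" .
  have bound: "ennreal \<bar>x\<bar> \<le> 1 + ennreal (1 / c\<^sub>0) * (\<Sum>k. ennreal (g k x))" for x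
  proof (cases "1 < \<bar>x\<bar>")
    case True
    then obtain k where "(1 - cos (1/2)) * \<bar>x\<bar> \<le> g k x"
      unfolding g_def by (rule abs_le_dyadic_one_minus_cos)
    then have "\<bar>x\<bar> \<le> (1 / c\<^sub>0) * g k x" using c0 by (simp add: c\<^sub>0_def[symmetric] field_simps)
    then have "ennreal \<bar>x\<bar> \<le> ennreal (1 / c\<^sub>0) * ennreal (g k x)"
      using c0 by (simp add: ennreal_mult'[symmetric] ennreal_leI)
    also have "ennreal (g k x) \<le> (\<Sum>k. ennreal (g k x))"
      using sum_le_suminf[of "\<lambda>k. ennreal (g k x)" "{k}"] by simp
    finally show ?thesis
      by (meson add_increasing mult_left_mono order_trans zero_le)
  next
    case False
    then have "ennreal \<bar>x\<bar> \<le> 1" by (simp add: ennreal_le_1)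
    then show ?thesis by (meson add_increasing2 zero_le)
  qed
  have "(\<integral>\<^sup>+\<omega>. ennreal \<bar>X \<omega>\<bar> \<partial>P) \<le> (\<integral>\<^sup>+\<omega>. 1 + ennreal (1 / c\<^sub>0) * (\<Sum>k. ennreal (g k (X \<omega>))) \<partial>P)"
    by (intro nn_integral_mono bound)
  also have "\<dots> = 1 + ennreal (1 / c\<^sub>0) * (\<integral>\<^sup>+\<omega>. (\<Sum>k. ennreal (g k (X \<omega>))) \<partial>P)"
    by (subst nn_integral_add) (auto simp: nn_integral_cmult emeasure_space_1)
  also have "\<dots> < \<infinity>" using fin by (simp add: ennreal_mult_less_top)
  finally show ?thesis by (simp add: integrable_iff_bounded)
qed

section \<open>The energy of a family of segments\<close>

text \<open>This form absorbs the orientation of the segment into the factor \<open>sgn x\<close>, which does not depend on \<open>u\<close>.\<close>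

lemma indicator_closed_segment_eq:
  fixes u x :: real
  assumes "x \<noteq> 0" "x \<noteq> u"
  shows "indicator (closed_segment 0 u) x = sgn x * (indicator {..<u} x - indicator {..<0} x)"
  using assms by (auto simp: indicator_def closed_segment_eq_real_ivl sgn_if)

text \<open>The \<open>\<alpha>\<close>-th power of the \<open>L\<^sup>\<alpha>\<close> norm of \<open>\<Sum> a\<^sub>t 1\<^bsub>[0,u\<^sub>t]\<^esub>\<close>. Its values lie in \<open>ennreal\<close>, so that Fubini and
  substitution apply without integrability conditions.\<close>

definition segment_energy :: "real \<Rightarrow> 'i set \<Rightarrow> ('i \<Rightarrow> real) \<Rightarrow> ('i \<Rightarrow> real) \<Rightarrow> ennreal" where
  "segment_energy \<alpha> J a u =
     (\<integral>\<^sup>+x. ennreal (\<bar>\<Sum>t\<in>J. a t * indicator (closed_segment 0 (u t)) x\<bar> powr \<alpha>) \<partial>lborel)"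

text \<open>Both sides become integrals of combinations of half-line indicators, up to the factor \<open>sgn x\<close>, which
  the absolute value removes; those integrals differ by the translation \<open>x \<mapsto> v + x\<close>.\<close>

lemma segment_energy_diff:
  assumes J: "finite J"
  shows "(\<integral>\<^sup>+x. ennreal (\<bar>\<Sum>t\<in>J. a t * (indicator (closed_segment 0 (u t)) x
      - indicator (closed_segment 0 v) x)\<bar> powr \<alpha>) \<partial>lborel) = segment_energy \<alpha> J a (\<lambda>t. u t - v)"
proof -
  let ?h = "\<lambda>u v x. ennreal (\<bar>\<Sum>t\<in>J. a t * (indicator {..<u t} x - indicator {..<v} x)\<bar> powr \<alpha>)"
  \<comment> \<open>the identity for segments fails at most at the end points\<close>
  have generic: "AE x in lborel. x \<notin> insert 0 (insert v (u ` J))" for u :: "'a \<Rightarrow> real" and v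
    by (rule AE_not_in, rule finite_imp_null_set_lborel) (use J in simp)
  have sgn1: "\<bar>sgn x * z\<bar> = \<bar>z\<bar>" if "x \<noteq> 0" for x z :: real
    using that by (simp add: abs_mult abs_sgn_eq)
  have "(\<integral>\<^sup>+x. ennreal (\<bar>\<Sum>t\<in>J. a t * (indicator (closed_segment 0 (u t)) x
      - indicator (closed_segment 0 v) x)\<bar> powr \<alpha>) \<partial>lborel) = (\<integral>\<^sup>+x. ?h u v x \<partial>lborel)"
  proof (rule nn_integral_cong_AE, use generic[of v u] in eventually_elim)
    fix x assume x: "x \<notin> insert 0 (insert v (u ` J))"
    have "(\<Sum>t\<in>J. a t * (indicator (closed_segment 0 (u t)) x - indicator (closed_segment 0 v) x))
        = (\<Sum>t\<in>J. a t * (sgn x * (indicator {..<u t} x - indicator {..<v} x)))"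
      by (rule sum.cong[OF refl], subst (1 2) indicator_closed_segment_eq)
        (use x in \<open>auto simp: algebra_simps\<close>)
    also have "\<dots> = sgn x * (\<Sum>t\<in>J. a t * (indicator {..<u t} x - indicator {..<v} x))"
      by (simp add: sum_distrib_left mult_ac)
    finally show "ennreal (\<bar>\<Sum>t\<in>J. a t * (indicator (closed_segment 0 (u t)) x
      - indicator (closed_segment 0 v) x)\<bar> powr \<alpha>) = ?h u v x"
      using x by (simp add: sgn1)
  qed
  also have "\<dots> = (\<integral>\<^sup>+x. ?h u v (v + 1 * x) \<partial>lborel)"
    by (subst nn_integral_real_affine[where c=1 and t=v]) auto
  also have "\<dots> = (\<integral>\<^sup>+x. ?h (\<lambda>t. u t - v) 0 x \<partial>lborel)"
    by (intro nn_integral_cong arg_cong[where f=ennreal] arg_cong[where f="\<lambda>z. \<bar>z\<bar> powr \<alpha>"] sum.cong refl)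
      (auto simp: indicator_def)
  also have "\<dots> = segment_energy \<alpha> J a (\<lambda>t. u t - v)"
    unfolding segment_energy_def
  proof (rule nn_integral_cong_AE, use generic[of 0 "\<lambda>t. u t - v"] in eventually_elim)
    fix x assume x: "x \<notin> insert 0 (insert 0 ((\<lambda>t. u t - v) ` J))"
    have "(\<Sum>t\<in>J. a t * indicator (closed_segment 0 (u t - v)) x)
        = (\<Sum>t\<in>J. a t * (sgn x * (indicator {..<u t - v} x - indicator {..<0} x)))"
      by (rule sum.cong[OF refl], subst indicator_closed_segment_eq) (use x in auto)
    also have "\<dots> = sgn x * (\<Sum>t\<in>J. a t * (indicator {..<u t - v} x - indicator {..<0} x))"
      by (simp add: sum_distrib_left mult_ac)
    finally show "?h (\<lambda>t. u t - v) 0 x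
        = ennreal (\<bar>\<Sum>t\<in>J. a t * indicator (closed_segment 0 (u t - v)) x\<bar> powr \<alpha>)"
      using x by (simp add: sgn1)
  qed
  finally show ?thesis .
qed

lemma mem_closed_segment_0:
  fixes u x :: real
  shows "x \<in> closed_segment 0 u \<longleftrightarrow> 0 \<le> x \<and> x \<le> u \<or> u \<le> x \<and> x \<le> 0"
  by (auto simp: closed_segment_eq_real_ivl)

lemma segment_energy_scale:
  assumes c: "0 < c"
  shows "segment_energy \<alpha> J a (\<lambda>t. c * u t) = ennreal c * segment_energy \<alpha> J a u"
proof -
  have [measurable]: "closed_segment 0 (u t) \<in> sets borel" for u :: "'a \<Rightarrow> real" and t
    by (simp add: closed_segment_eq_real_ivl)
  have scale: "c * x \<in> closed_segment 0 (c * u t) \<longleftrightarrow> x \<in> closed_segment 0 (u t)" for x t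
    using c by (simp add: mem_closed_segment_0 zero_le_mult_iff mult_le_0_iff)
  have "segment_energy \<alpha> J a (\<lambda>t. c * u t) = ennreal \<bar>c\<bar> *
     (\<integral>\<^sup>+x. ennreal (\<bar>\<Sum>t\<in>J. a t * indicator (closed_segment 0 (c * u t)) (0 + c * x)\<bar> powr \<alpha>) \<partial>lborel)"
    unfolding segment_energy_def by (rule nn_integral_real_affine) (use c in auto)
  then show ?thesis
    using c by (simp add: segment_energy_def indicator_def scale)
qed

lemma measurable_closed_segment_0:
  fixes U V :: "'a \<Rightarrow> real"
  assumes [measurable]: "U \<in> borel_measurable N" "V \<in> borel_measurable N"
  shows "(\<lambda>p. indicator (closed_segment 0 (U p)) (V p) :: real) \<in> borel_measurable N"
  unfolding indicator_def mem_closed_segment_0 by measurable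

lemma measurable_segment_energy[measurable]:
  "segment_energy \<alpha> J a \<in> borel_measurable (PiM J (\<lambda>_. borel))"
proof -
  have "(\<lambda>p :: ('a \<Rightarrow> real) \<times> real. indicator (closed_segment 0 (fst p t)) (snd p) :: real)
      \<in> borel_measurable (PiM J (\<lambda>_. borel) \<Otimes>\<^sub>M lborel)" if "t \<in> J" for t
    by (rule measurable_closed_segment_0)
      (auto intro!: measurable_compose[OF measurable_fst measurable_component_singleton] that)
  then have "(\<lambda>p :: ('a \<Rightarrow> real) \<times> real. \<Sum>t\<in>J. a t * indicator (closed_segment 0 (fst p t)) (snd p))
      \<in> borel_measurable (PiM J (\<lambda>_. borel) \<Otimes>\<^sub>M lborel)"
    by (intro borel_measurable_sum borel_measurable_times borel_measurable_const)
  then have "(\<lambda>p :: ('a \<Rightarrow> real) \<times> real. ennreal (\<bar>\<Sum>t\<in>J. a t * indicator (closed_segment 0 (fst p t)) (snd p)\<bar> powr \<alpha>))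
      \<in> borel_measurable (PiM J (\<lambda>_. borel) \<Otimes>\<^sub>M lborel)"
    by (rule measurable_compose) measurable
  then show ?thesis
    unfolding segment_energy_def[abs_def]
    by (intro lborel.borel_measurable_nn_integral) (simp add: case_prod_beta')
qed

lemma segment_energy_restrict:
  "segment_energy \<alpha> J a (restrict u J) = segment_energy \<alpha> J a u"
  unfolding segment_energy_def by (simp cong: sum.cong)

lemma
  assumes W: "\<And>t. t \<in> J \<Longrightarrow> W t \<in> borel_measurable Q"
  shows measurable_segment_energy_process:
      "(\<lambda>\<omega>. segment_energy \<alpha> J a (\<lambda>t. W t \<omega>)) \<in> borel_measurable Q"
    and nn_integral_fdd_segment_energy:
      "(\<integral>\<^sup>+u. segment_energy \<alpha> J a u \<partial>fdd Q W J) = (\<integral>\<^sup>+\<omega>. segment_energy \<alpha> J a (\<lambda>t. W t \<omega>) \<partial>Q)"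
proof -
  have [measurable]: "(\<lambda>\<omega>. \<lambda>t\<in>J. W t \<omega>) \<in> measurable Q (PiM J (\<lambda>_. borel))"
    by (rule measurable_restrict) (rule W)
  have "(\<lambda>\<omega>. segment_energy \<alpha> J a (\<lambda>t\<in>J. W t \<omega>)) \<in> borel_measurable Q" by measurable
  then show "(\<lambda>\<omega>. segment_energy \<alpha> J a (\<lambda>t. W t \<omega>)) \<in> borel_measurable Q"
    by (simp only: segment_energy_restrict)
  show "(\<integral>\<^sup>+u. segment_energy \<alpha> J a u \<partial>fdd Q W J) = (\<integral>\<^sup>+\<omega>. segment_energy \<alpha> J a (\<lambda>t. W t \<omega>) \<partial>Q)"
    unfolding fdd_def by (simp add: nn_integral_distr segment_energy_restrict)
qed

lemma measurable_segment_slice: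
  fixes W :: "'v \<Rightarrow> real"
  assumes "W \<in> borel_measurable Q"
  shows "(\<lambda>p. indicator (closed_segment 0 (W (fst p))) (snd p) :: real) \<in> borel_measurable (Q \<Otimes>\<^sub>M lborel)"
  by (rule measurable_closed_segment_0) (auto intro: measurable_compose[OF measurable_fst assms])

lemma integral_powr_eq_iterated_nn_integral:
  assumes [measurable]: "F \<in> borel_measurable (Q \<Otimes>\<^sub>M lborel)"
  shows "(\<integral>p. F p powr \<alpha> \<partial>(Q \<Otimes>\<^sub>M lborel))
      = enn2real (\<integral>\<^sup>+\<omega>. \<integral>\<^sup>+x. ennreal (F (\<omega>, x) powr \<alpha>) \<partial>lborel \<partial>Q)"
proof -
  have "(\<integral>p. F p powr \<alpha> \<partial>(Q \<Otimes>\<^sub>M lborel)) = enn2real (\<integral>\<^sup>+p. ennreal (F p powr \<alpha>) \<partial>(Q \<Otimes>\<^sub>M lborel))"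
    by (rule integral_eq_nn_integral) auto
  moreover have "(\<lambda>p. ennreal (F p powr \<alpha>)) \<in> borel_measurable (Q \<Otimes>\<^sub>M lborel)" by measurable
  ultimately show ?thesis by (simp only: lborel.nn_integral_fst[symmetric])
qed

lemma integral_segment_combination:
  fixes U :: "real \<Rightarrow> 'v \<Rightarrow> real"
  assumes U: "\<And>t. t \<in> J \<Longrightarrow> U t \<in> borel_measurable Q"
  shows "(\<integral>p. \<bar>\<Sum>t\<in>J. a t * indicator (closed_segment 0 (U t (fst p))) (snd p)\<bar> powr \<alpha> \<partial>(Q \<Otimes>\<^sub>M lborel))
      = enn2real (\<integral>\<^sup>+u. segment_energy \<alpha> J a u \<partial>fdd Q U J)"
proof -
  note [measurable] = measurable_segment_slice[OF U]
  show ?thesis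
    by (subst integral_powr_eq_iterated_nn_integral, measurable, subst nn_integral_fdd_segment_energy)
      (auto simp: segment_energy_def U)
qed

lemma integral_segment_combination_diff:
  fixes U :: "real \<Rightarrow> 'v \<Rightarrow> real"
  assumes J: "finite J" and U: "\<And>t. t \<in> J \<Longrightarrow> U t \<in> borel_measurable Q" and V: "V \<in> borel_measurable Q"
  shows "(\<integral>p. \<bar>\<Sum>t\<in>J. a t * (indicator (closed_segment 0 (U t (fst p))) (snd p)
        - indicator (closed_segment 0 (V (fst p))) (snd p))\<bar> powr \<alpha> \<partial>(Q \<Otimes>\<^sub>M lborel))
      = enn2real (\<integral>\<^sup>+u. segment_energy \<alpha> J a u \<partial>fdd Q (\<lambda>t \<omega>. U t \<omega> - V \<omega>) J)"
proof -
  note [measurable] = measurable_segment_slice[OF U] measurable_segment_slice[OF V]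
  show ?thesis
    by (subst integral_powr_eq_iterated_nn_integral, measurable, subst nn_integral_fdd_segment_energy)
      (auto simp: segment_energy_diff[OF J] intro!: borel_measurable_diff U V)
qed

section \<open>The process of segment integrals\<close>

definition segment_set :: "'v measure \<Rightarrow> ('v \<Rightarrow> real) \<Rightarrow> ('v \<times> real) set" where
  "segment_set Q U = {p \<in> space (Q \<Otimes>\<^sub>M lborel). snd p \<in> closed_segment 0 (U (fst p))}"

text \<open>The section of the set at \<open>\<omega>\<close> is a segment of length \<open>\<bar>U \<omega>\<bar>\<close>.\<close>

lemma segment_set_finite_measure:
  assumes U: "integrable Q U"
  shows "segment_set Q U \<in> finite_measure_sets (Q \<Otimes>\<^sub>M lborel)"
proof -
  have [measurable]: "U \<in> borel_measurable Q" using U by simp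
  have meas: "segment_set Q U \<in> sets (Q \<Otimes>\<^sub>M lborel)"
    unfolding segment_set_def mem_closed_segment_0 by measurable
  have "emeasure (Q \<Otimes>\<^sub>M lborel) (segment_set Q U)
      = (\<integral>\<^sup>+\<omega>. emeasure lborel (Pair \<omega> -` segment_set Q U) \<partial>Q)"
    by (rule lborel.emeasure_pair_measure_alt[OF meas])
  also have "\<dots> = (\<integral>\<^sup>+\<omega>. ennreal (norm (U \<omega>)) \<partial>Q)"
  proof (rule nn_integral_cong)
    fix \<omega> assume "\<omega> \<in> space Q"
    then have "Pair \<omega> -` segment_set Q U = closed_segment 0 (U \<omega>)"
      by (auto simp: segment_set_def space_pair_measure)
    then show "emeasure lborel (Pair \<omega> -` segment_set Q U) = ennreal (norm (U \<omega>))"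
      by (simp add: closed_segment_eq_real_ivl)
  qed
  also have "\<dots> < \<infinity>" using U by (simp add: integrable_iff_bounded)
  finally show ?thesis using meas by (simp add: finite_measure_sets_def)
qed

lemma Y_kernel_eq_indicator:
  "p \<in> space (Q \<Otimes>\<^sub>M lborel) \<Longrightarrow> Y_kernel A t p = indicator (segment_set Q (A t)) p"
  by (auto simp: Y_kernel_def segment_set_def indicator_def split: prod.split)

lemma Y_kernel_alt: "Y_kernel A t p = indicator (closed_segment 0 (A t (fst p))) (snd p)"
  by (simp add: Y_kernel_def case_prod_beta)

locale segment_kernel_process = stable_random_measure P \<alpha> "Q \<Otimes>\<^sub>M lborel" M
  for P :: "'w measure" and \<alpha> and Q :: "'v measure" and M +
  fixes A :: "real \<Rightarrow> 'v \<Rightarrow> real" and Y :: "real \<Rightarrow> 'w \<Rightarrow> real"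
  assumes A: "\<And>t. 0 \<le> t \<Longrightarrow> integrable Q (A t)"
    and Y: "\<And>t. 0 \<le> t \<Longrightarrow> has_stable_integral P \<alpha> (Q \<Otimes>\<^sub>M lborel) M (Y_kernel A t) (Y t)"
begin

lemma borel_measurable_A: "0 \<le> t \<Longrightarrow> A t \<in> borel_measurable Q"
  using A by auto

lemma borel_measurable_Y: "0 \<le> t \<Longrightarrow> Y t \<in> borel_measurable P"
  using Y by (simp add: has_stable_integral_def)

lemma char_sum_Y:
  assumes "finite I" "\<And>i. i \<in> I \<Longrightarrow> 0 \<le> \<tau> i"
  shows "char (distr P borel (\<lambda>\<omega>. \<Sum>i\<in>I. a i * Y (\<tau> i) \<omega>)) \<theta>
    = complex_of_real (exp (- (\<integral>p. \<bar>\<Sum>i\<in>I. a i * Y_kernel A (\<tau> i) p\<bar> powr \<alpha> \<partial>(Q \<Otimes>\<^sub>M lborel)) * \<bar>\<theta>\<bar> powr \<alpha>))"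
  by (rule char_sum_stable_integrals[where E="\<lambda>i. segment_set Q (A (\<tau> i))"])
    (use assms in \<open>auto intro: segment_set_finite_measure A Y Y_kernel_eq_indicator\<close>)

lemma SaS_process_Y: "SaS_process P \<alpha> Y"
  unfolding SaS_process_def SaS_variable_def
proof (intro allI impI)
  fix J :: "real set" and a assume J: "finite J" "J \<subseteq> {0..}"
  define I where "I = (\<integral>p. \<bar>\<Sum>t\<in>J. a t * Y_kernel A t p\<bar> powr \<alpha> \<partial>(Q \<Otimes>\<^sub>M lborel))"
  have "I \<ge> 0" unfolding I_def by (rule Bochner_Integration.integral_nonneg) simp
  then have "(I powr (1 / \<alpha>)) powr \<alpha> = I" using \<alpha>_pos by (simp add: powr_powr)
  moreover have "(\<lambda>\<omega>. \<Sum>t\<in>J. a t * Y t \<omega>) \<in> borel_measurable P"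
    using J by (intro borel_measurable_sum borel_measurable_times borel_measurable_const borel_measurable_Y) auto
  moreover have "char (distr P borel (\<lambda>\<omega>. \<Sum>t\<in>J. a t * Y t \<omega>)) \<theta>
      = complex_of_real (exp (- I * \<bar>\<theta>\<bar> powr \<alpha>))" for \<theta>
    unfolding I_def by (rule char_sum_Y) (use J in auto)
  ultimately have "has_SaS_law P \<alpha> (I powr (1 / \<alpha>)) (\<lambda>\<omega>. \<Sum>t\<in>J. a t * Y t \<omega>)"
    unfolding has_SaS_law_def by simp
  then show "\<exists>\<sigma>\<ge>0. has_SaS_law P \<alpha> \<sigma> (\<lambda>\<omega>. \<Sum>t\<in>J. a t * Y t \<omega>)"
    by (intro exI[of _ "I powr (1 / \<alpha>)"]) simp
qed

text \<open>The increments over \<open>J\<close> involve \<open>Y(t + h)\<close> and \<open>Y(h)\<close>. The combination is indexed by pairs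
  \<open>(t, b)\<close> with \<open>b\<close> telling which of the two values is meant, since \<open>h\<close> may coincide with one of the \<open>t + h\<close>.\<close>

lemma char_sum_Y_increments:
  assumes J: "finite J" "J \<subseteq> {0..}" and h: "0 \<le> h"
  shows "char (distr P borel (\<lambda>\<omega>. \<Sum>t\<in>J. a t * (Y (t + h) \<omega> - Y h \<omega>))) \<theta>
    = complex_of_real (exp (- enn2real (\<integral>\<^sup>+u. segment_energy \<alpha> J a u \<partial>fdd Q (\<lambda>t \<omega>. A (t + h) \<omega> - A h \<omega>) J)
        * \<bar>\<theta>\<bar> powr \<alpha>))"
proof -
  define b where "b i = (if snd i then a (fst i) else - a (fst i))" for i :: "real \<times> bool"
  define \<tau> where "\<tau> i = (if snd i then fst i + h else h)" for i :: "real \<times> bool"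
  have split: "(\<Sum>i\<in>J \<times> UNIV. b i * g (\<tau> i)) = (\<Sum>t\<in>J. a t * (g (t + h) - g h))" for g :: "real \<Rightarrow> real"
    unfolding sum.cartesian_product'
    by (rule sum.cong[OF refl]) (simp add: UNIV_bool b_def \<tau>_def algebra_simps)
  have "char (distr P borel (\<lambda>\<omega>. \<Sum>i\<in>J \<times> UNIV. b i * Y (\<tau> i) \<omega>)) \<theta>
    = complex_of_real (exp (- (\<integral>p. \<bar>\<Sum>i\<in>J \<times> UNIV. b i * Y_kernel A (\<tau> i) p\<bar> powr \<alpha> \<partial>(Q \<Otimes>\<^sub>M lborel)) * \<bar>\<theta>\<bar> powr \<alpha>))"
    by (rule char_sum_Y) (use J h in \<open>auto simp: \<tau>_def\<close>)
  moreover have "(\<Sum>i\<in>J \<times> UNIV. b i * Y (\<tau> i) \<omega>) = (\<Sum>t\<in>J. a t * (Y (t + h) \<omega> - Y h \<omega>))" for \<omega>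
    by (rule split)
  moreover have "(\<Sum>i\<in>J \<times> UNIV. b i * Y_kernel A (\<tau> i) p)
      = (\<Sum>t\<in>J. a t * (Y_kernel A (t + h) p - Y_kernel A h p))" for p
    by (rule split)
  moreover have "(\<integral>p. \<bar>\<Sum>t\<in>J. a t * (Y_kernel A (t + h) p - Y_kernel A h p)\<bar> powr \<alpha> \<partial>(Q \<Otimes>\<^sub>M lborel))
      = enn2real (\<integral>\<^sup>+u. segment_energy \<alpha> J a u \<partial>fdd Q (\<lambda>t \<omega>. A (t + h) \<omega> - A h \<omega>) J)"
    unfolding Y_kernel_alt
    by (rule integral_segment_combination_diff) (use J h in \<open>auto intro!: borel_measurable_A\<close>)
  ultimately show ?thesis by simp
qed

lemma stationary_increments_Y:
  assumes stat: "stationary_increments Q A"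
  shows "stationary_increments P Y"
  unfolding stationary_increments_def
proof (intro allI impI)
  fix h :: real assume h: "0 \<le> h"
  show "same_fdds P (\<lambda>t \<omega>. Y (t + h) \<omega> - Y h \<omega>) (\<lambda>t \<omega>. Y t \<omega> - Y 0 \<omega>)"
  proof (rule same_fddsI)
    show "prob_space P" by unfold_locales
    fix J :: "real set" and a assume J: "finite J" "J \<subseteq> {0..}"
    have "fdd Q (\<lambda>t \<omega>. A (t + h) \<omega> - A h \<omega>) J = fdd Q (\<lambda>t \<omega>. A t \<omega> - A 0 \<omega>) J"
      using stat h J by (simp add: stationary_increments_def same_fdds_def)
    then show "char (distr P borel (\<lambda>\<omega>. \<Sum>t\<in>J. a t * (Y (t + h) \<omega> - Y h \<omega>))) 1
        = char (distr P borel (\<lambda>\<omega>. \<Sum>t\<in>J. a t * (Y t \<omega> - Y 0 \<omega>))) 1"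
      using char_sum_Y_increments[OF J h] char_sum_Y_increments[OF J, of 0] by simp
  qed (use h in \<open>auto intro!: borel_measurable_diff borel_measurable_Y\<close>)
qed

text \<open>Homogeneity of the energy extracts \<open>c\<^sup>H\<close> from the left-hand exponent; on the right the factor \<open>k = c\<^bsup>H/\<alpha>\<^esup>\<close> of
  the coefficients yields \<open>k\<^sup>\<alpha> = c\<^sup>H\<close>.\<close>

lemma self_similar_Y:
  assumes sim: "self_similar Q H A"
  shows "self_similar P (H / \<alpha>) Y"
  unfolding self_similar_def
proof (intro allI impI)
  fix c :: real assume c: "0 < c"
  define k where "k = c powr (H / \<alpha>)"
  have k: "k powr \<alpha> = c powr H" using \<alpha>_pos by (simp add: k_def powr_powr)
  have k0: "0 < k" using c by (simp add: k_def)
  show "same_fdds P (\<lambda>t. Y (c * t)) (\<lambda>t \<omega>. c powr (H / \<alpha>) * Y t \<omega>)"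
    unfolding k_def[symmetric]
  proof (rule same_fddsI)
    show "prob_space P" by unfold_locales
    fix J :: "real set" and a assume J: "finite J" "J \<subseteq> {0..}"
    have A': "A (c * t) \<in> borel_measurable Q" "A t \<in> borel_measurable Q" if "t \<in> J" for t
      using that J c by (auto intro!: borel_measurable_A)
    have cA: "(\<lambda>\<omega>. c powr H * A t \<omega>) \<in> borel_measurable Q" if "t \<in> J" for t
      using A'(2)[OF that] by simp
    have cH: "0 < c powr H" using c by simp
    have expand: "(\<integral>\<^sup>+u. segment_energy \<alpha> J a u \<partial>fdd Q W J) = (\<integral>\<^sup>+\<omega>. segment_energy \<alpha> J a (\<lambda>t. W t \<omega>) \<partial>Q)"
      if "\<And>t. t \<in> J \<Longrightarrow> W t \<in> borel_measurable Q" for W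
      using that by (rule nn_integral_fdd_segment_energy)
    have meas: "(\<lambda>\<omega>. segment_energy \<alpha> J a (\<lambda>t. A t \<omega>)) \<in> borel_measurable Q"
      using A'(2) by (rule measurable_segment_energy_process)
    have "(\<integral>p. \<bar>\<Sum>t\<in>J. a t * Y_kernel A (c * t) p\<bar> powr \<alpha> \<partial>(Q \<Otimes>\<^sub>M lborel))
        = enn2real (\<integral>\<^sup>+u. segment_energy \<alpha> J a u \<partial>fdd Q (\<lambda>t. A (c * t)) J)"
      unfolding Y_kernel_alt by (rule integral_segment_combination[OF A'(1)])
    also have "fdd Q (\<lambda>t. A (c * t)) J = fdd Q (\<lambda>t \<omega>. c powr H * A t \<omega>) J"
      using sim c J by (simp add: self_similar_def same_fdds_def)
    also have "(\<integral>\<^sup>+u. segment_energy \<alpha> J a u \<partial>fdd Q (\<lambda>t \<omega>. c powr H * A t \<omega>) J)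
        = (\<integral>\<^sup>+\<omega>. ennreal (c powr H) * segment_energy \<alpha> J a (\<lambda>t. A t \<omega>) \<partial>Q)"
      unfolding segment_energy_scale[OF cH, symmetric] by (rule expand[OF cA])
    also have "\<dots> = ennreal (c powr H) * (\<integral>\<^sup>+\<omega>. segment_energy \<alpha> J a (\<lambda>t. A t \<omega>) \<partial>Q)"
      by (rule nn_integral_cmult[OF meas])
    also have "enn2real \<dots> = c powr H * enn2real (\<integral>\<^sup>+u. segment_energy \<alpha> J a u \<partial>fdd Q A J)"
      by (simp add: enn2real_mult expand[OF A'(2)])
    also have "enn2real (\<integral>\<^sup>+u. segment_energy \<alpha> J a u \<partial>fdd Q A J)
        = (\<integral>p. \<bar>\<Sum>t\<in>J. a t * Y_kernel A t p\<bar> powr \<alpha> \<partial>(Q \<Otimes>\<^sub>M lborel))"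
      unfolding Y_kernel_alt by (rule integral_segment_combination[OF A'(2), symmetric])
    also have "c powr H * \<dots> = (\<integral>p. \<bar>\<Sum>t\<in>J. (a t * k) * Y_kernel A t p\<bar> powr \<alpha> \<partial>(Q \<Otimes>\<^sub>M lborel))"
    proof -
      have "\<bar>\<Sum>t\<in>J. (a t * k) * Y_kernel A t p\<bar> powr \<alpha> = c powr H * \<bar>\<Sum>t\<in>J. a t * Y_kernel A t p\<bar> powr \<alpha>" for p
      proof -
        have "(\<Sum>t\<in>J. (a t * k) * Y_kernel A t p) = k * (\<Sum>t\<in>J. a t * Y_kernel A t p)"
          by (simp add: sum_distrib_left mult_ac)
        then show ?thesis using k0 by (simp add: abs_mult powr_mult k)
      qed
      then show ?thesis by simp
    qed
    finally have energies: "(\<integral>p. \<bar>\<Sum>t\<in>J. a t * Y_kernel A (c * t) p\<bar> powr \<alpha> \<partial>(Q \<Otimes>\<^sub>M lborel))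
        = (\<integral>p. \<bar>\<Sum>t\<in>J. (a t * k) * Y_kernel A t p\<bar> powr \<alpha> \<partial>(Q \<Otimes>\<^sub>M lborel))" .
    have "char (distr P borel (\<lambda>\<omega>. \<Sum>t\<in>J. a t * Y (c * t) \<omega>)) 1
        = char (distr P borel (\<lambda>\<omega>. \<Sum>t\<in>J. (a t * k) * Y t \<omega>)) 1"
      by (subst (1 2) char_sum_Y) (use J c energies in auto)
    then show "char (distr P borel (\<lambda>\<omega>. \<Sum>t\<in>J. a t * Y (c * t) \<omega>)) 1
        = char (distr P borel (\<lambda>\<omega>. \<Sum>t\<in>J. a t * (k * Y t \<omega>))) 1"
      by (simp add: mult.assoc)
  qed (use c in \<open>auto intro!: borel_measurable_times borel_measurable_Y\<close>)
qed

end

theorem theorem2p2: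
  fixes \<alpha> \<beta> H' :: real
    and P' :: "'v measure" and P :: "'w measure"
    and A :: "real \<Rightarrow> 'v \<Rightarrow> real"
    and M :: "('v \<times> real) set \<Rightarrow> 'w \<Rightarrow> real"
  assumes "0 < \<alpha>" "\<alpha> < 2" and "1 < \<beta>" "\<beta> \<le> 2" and "0 < H'" "H' < 1"
    and "prob_space P'"
    and "SaS_process P' \<beta> A" and "nondegenerate_process P' A"
    and "stationary_increments P' A" and "self_similar P' H' A"
    and "prob_space P"
    and "SaS_random_measure P \<alpha> (P' \<Otimes>\<^sub>M lborel) M"
  shows "(\<forall>t\<ge>0. Y_kernel A t \<in> L_space \<alpha> (P' \<Otimes>\<^sub>M lborel)
            \<and> (\<exists>X. has_stable_integral P \<alpha> (P' \<Otimes>\<^sub>M lborel) M (Y_kernel A t) X))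
       \<and> (\<forall>Y :: real \<Rightarrow> 'w \<Rightarrow> real.
            (\<forall>t\<ge>0. has_stable_integral P \<alpha> (P' \<Otimes>\<^sub>M lborel) M (Y_kernel A t) (Y t)) \<longrightarrow>
            SaS_process P \<alpha> Y \<and> stationary_increments P Y \<and> self_similar P (H' / \<alpha>) Y)"
proof -
  have A: "integrable P' (A t)" if "0 \<le> t" for t
  proof -
    have "SaS_variable P' \<beta> (\<lambda>\<omega>. \<Sum>s\<in>J. a s * A s \<omega>)" if "finite J" "J \<subseteq> {0..}" for J a
      using \<open>SaS_process P' \<beta> A\<close> that by (simp add: SaS_process_def)
    from this[of "{t}" "\<lambda>_. 1"] that have "SaS_variable P' \<beta> (A t)" by simp
    then obtain \<sigma> where "has_SaS_law P' \<beta> \<sigma> (A t)" by (auto simp: SaS_variable_def)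
    then show ?thesis using \<open>prob_space P'\<close> \<open>1 < \<beta>\<close> by (intro integrable_SaS_law)
  qed
  interpret stable_random_measure P \<alpha> "P' \<Otimes>\<^sub>M lborel" M
    using assms by (simp add: stable_random_measure_def stable_random_measure_axioms_def)
  show ?thesis
  proof (intro conjI allI impI)
    fix t :: real assume t: "0 \<le> t"
    note E = Y_kernel_eq_indicator segment_set_finite_measure[OF A[OF t]]
    show "Y_kernel A t \<in> L_space \<alpha> (P' \<Otimes>\<^sub>M lborel)"
      by (rule indicator_in_L_space[where E="segment_set P' (A t)"]) (rule E, assumption?)+
    show "\<exists>X. has_stable_integral P \<alpha> (P' \<Otimes>\<^sub>M lborel) M (Y_kernel A t) X"
      by (rule stable_integral_indicator_exists[where E="segment_set P' (A t)"]) (rule E, assumption?)+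
  next
    fix Y :: "real \<Rightarrow> 'w \<Rightarrow> real"
    assume "\<forall>t\<ge>0. has_stable_integral P \<alpha> (P' \<Otimes>\<^sub>M lborel) M (Y_kernel A t) (Y t)"
    then interpret segment_kernel_process P \<alpha> P' M A Y
      by unfold_locales (use A in auto)
    show "SaS_process P \<alpha> Y" by (rule SaS_process_Y)
    show "stationary_increments P Y" by (rule stationary_increments_Y) fact
    show "self_similar P (H' / \<alpha>) Y" by (rule self_similar_Y) fact
  qed
qed

end
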